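(* Let $G$ be a Garside group, the group of fractions of a Garside monoid $M$ with Garside element $\delta$ and set of simple elements $D$. Let $x\in G$ and $y,z\in U_x$. There exist elements $y_0,\dots,y_t\in U_x$ and elements $c_1,\dots,c_t\in D$ such that $y_0=y$, $y_t=z$ and $y_{i-1}^{c_i}=y_i$ for $i=1,\dots,t$.
   Context: **Garside monoids and groups.** Let $M$ be a (left and right) cancellative monoid. For $a,b\in M$ write $a\preceq b$ if $ac=b$ for some $c\in M$, and $a\succeq b$ if $a=cb$ for some $c\in M$. The (left) gcd $a\wedge b$ and (left) lcm $a\vee b$ are the greatest lower bound and least upper bound with respect to $\preceq$. An atom is an element $x\neq 1$ such that $x=ab$ with $a,b\in M$ implies $a=1$ or $b=1$. $M$ is atomic if it is generated by its atoms and for every $a\in M$ there is a bound $N_a$ such that $a$ is not a product of more than $N_a$ atoms. An element $\delta\in M$ is a Garside element if $\{x\in M: x\preceq\delta\}=\{x\in M:\delta\succeq x\}$ and this set is finite and generates $M$. $M$ is a Garside monoid if it is atomic, has a Garside element $\delta$, and gcd and lcm of any $a,b\in M$ exist (they are then unique). Its group of fractions $G$ is called a Garside group; $M$ embeds in $G$ and is identified with its image. The set of simple elements is $D=\{x\in M: x\preceq\delta\}$. Extend $\preceq$ to $G$ by: $a\preceq b$ iff $a^{-1}b\in M$; the notions $\wedge,\vee$ extend to $G$. Conjugation is $x^c=c^{-1}xc$, and $\tau(x)=x^\delta=\delta^{-1}x\delta$; $\tau$ preserves $M$ and $\preceq$. **Normal form.** For $x\in G$ let $\inf(x)$ be the maximal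 integer $k$ with $\delta^k\preceq x$, $\sup(x)$ the minimal integer $m$ with $x\preceq\delta^m$, and $\mathrm{len}(x)=\sup(x)-\inf(x)\ge 0$. With $k=\inf(x)$, $r=\mathrm{len}(x)$, there are unique $A_1,\dots,A_r\in D$ with $x=\delta^kA_1\cdots A_r$ and $A_i^{-1}\delta\wedge A_{i+1}=1$ for $i=1,\dots,r-1$; this is the normal form of $x$. **Super summit set.** $S_x$ is the set of conjugates $y$ of $x$ in $G$ for which $\inf(y)$ is maximal and $\sup(y)$ is minimal among all conjugates of $x$ (this set is finite and nonempty). **Cycling.** If $x$ has normal form $\delta^kA_1\cdots A_r$, put $\mathbf{c}(x)=x$ if $r=0$ and $\mathbf{c}(x)=x^{\tau^{-k}(A_1)}$ otherwise. Cycling maps $S_x$ to itself. **Ultra summit set.** $U_x=\{y\in S_x:\mathbf{c}^k(y)=y\text{ for some }k>0\}$. *)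

theory Defs
  imports "HOL-Algebra.Divisibility"
begin

text \<open>
  In a monoid \<open>M\<close>, the library relation \<open>a divides\<^bsub>M\<^esub> b\<close> means \<open>b = a \<otimes> c\<close> for some
  \<open>c\<close> in \<open>M\<close>. For a noncommutative \<open>M\<close> this is the prefix order \<open>a \<preceq> b\<close>, and
  \<open>gcdof\<close>, \<open>lcmof\<close> are the left gcd and left lcm. The suffix order is not in the library.
\<close>

definition rdivides :: "('a, 'b) monoid_scheme \<Rightarrow> 'a \<Rightarrow> 'a \<Rightarrow> bool" where
  "rdivides M b a \<longleftrightarrow> (\<exists>c\<in>carrier M. a = c \<otimes>\<^bsub>M\<^esub> b)"

definition monoid_atom :: "('a, 'b) monoid_scheme \<Rightarrow> 'a \<Rightarrow> bool" where
  "monoid_atom M x \<longleftrightarrow> x \<in> carrier M \<and> x \<noteq> \<one>\<^bsub>M\<^esub> \<and>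
     (\<forall>a\<in>carrier M. \<forall>b\<in>carrier M. x = a \<otimes>\<^bsub>M\<^esub> b \<longrightarrow> a = \<one>\<^bsub>M\<^esub> \<or> b = \<one>\<^bsub>M\<^esub>)"

definition monoid_list_prod :: "('a, 'b) monoid_scheme \<Rightarrow> 'a list \<Rightarrow> 'a" where
  "monoid_list_prod M as = foldr (\<otimes>\<^bsub>M\<^esub>) as \<one>\<^bsub>M\<^esub>"

definition generates_monoid :: "('a, 'b) monoid_scheme \<Rightarrow> 'a set \<Rightarrow> bool" where
  "generates_monoid M A \<longleftrightarrow> carrier M = {monoid_list_prod M as | as. set as \<subseteq> A}"

definition atomic_monoid :: "('a, 'b) monoid_scheme \<Rightarrow> bool" where
  "atomic_monoid M \<longleftrightarrow> generates_monoid M {x. monoid_atom M x} \<and>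
     (\<forall>a\<in>carrier M. \<exists>N. \<forall>as. (\<forall>x\<in>set as. monoid_atom M x) \<and> monoid_list_prod M as = a
        \<longrightarrow> length as \<le> N)"

definition garside_element :: "('a, 'b) monoid_scheme \<Rightarrow> 'a \<Rightarrow> bool" where
  "garside_element M \<delta> \<longleftrightarrow> \<delta> \<in> carrier M \<and>
     {x \<in> carrier M. x divides\<^bsub>M\<^esub> \<delta>} = {x \<in> carrier M. rdivides M x \<delta>} \<and>
     finite {x \<in> carrier M. x divides\<^bsub>M\<^esub> \<delta>} \<and>
     generates_monoid M {x \<in> carrier M. x divides\<^bsub>M\<^esub> \<delta>}"

locale garside_monoid = monoid_cancel M for M (structure) +
  fixes \<delta> :: 'a
  assumes atomic: "atomic_monoid M"
    and garside_element: "garside_element M \<delta>"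
    and gcd_exists: "\<lbrakk>a \<in> carrier M; b \<in> carrier M\<rbrakk> \<Longrightarrow> \<exists>d\<in>carrier M. d gcdof a b"
    and lcm_exists: "\<lbrakk>a \<in> carrier M; b \<in> carrier M\<rbrakk> \<Longrightarrow> \<exists>m\<in>carrier M. m lcmof a b"

text \<open>
  The Garside monoid is identified with its image \<open>M\<close> in its group of fractions \<open>G\<close>, so it is
  the submonoid \<open>M\<close> of \<open>G\<close> with the operations of \<open>G\<close>. Any two elements of \<open>M\<close> have a common
  multiple of the form \<open>a \<otimes> c = b \<otimes> d\<close>, hence the fractions can be written \<open>a \<otimes> inv b\<close>.
\<close>

locale garside_group = group G for G (structure) +
  fixes M :: "'a set" and \<delta> :: 'a
  assumes submonoid: "submonoid M G"
    and garside_monoid: "garside_monoid (G\<lparr>carrier := M\<rparr>) \<delta>"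
    and fractions: "carrier G = {a \<otimes> inv b | a b. a \<in> M \<and> b \<in> M}"
begin

abbreviation submon where "submon \<equiv> G\<lparr>carrier := M\<rparr>"

definition simples :: "'a set" where
  "simples = {x \<in> M. x divides\<^bsub>submon\<^esub> \<delta>}"

definition prefix_le :: "'a \<Rightarrow> 'a \<Rightarrow> bool" where
  "prefix_le a b \<longleftrightarrow> inv a \<otimes> b \<in> M"

definition conjugate :: "'a \<Rightarrow> 'a \<Rightarrow> 'a" where
  "conjugate x c = inv c \<otimes> x \<otimes> c"

text \<open>The \<open>k\<close>-th iterate of \<open>\<tau>(x) = inv \<delta> \<otimes> x \<otimes> \<delta>\<close>, for any integer \<open>k\<close>.\<close>

definition tau_pow :: "int \<Rightarrow> 'a \<Rightarrow> 'a" where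
  "tau_pow k x = conjugate x (\<delta> [^] k)"

definition inf_exp :: "'a \<Rightarrow> int" where
  "inf_exp x = (GREATEST k. prefix_le (\<delta> [^] k) x)"

definition sup_exp :: "'a \<Rightarrow> int" where
  "sup_exp x = (LEAST m. prefix_le x (\<delta> [^] m))"

definition canonical_length :: "'a \<Rightarrow> int" where
  "canonical_length x = sup_exp x - inf_exp x"

text \<open>
  In the gcd condition both arguments lie in \<open>M\<close>, because simple elements are prefixes of \<open>\<delta>\<close>;
  so the gcd is the one of \<open>M\<close>.
\<close>

definition is_normal_form :: "'a \<Rightarrow> 'a list \<Rightarrow> bool" where
  "is_normal_form x as \<longleftrightarrow>
     set as \<subseteq> simples \<and>
     int (length as) = canonical_length x \<and>
     x = \<delta> [^] inf_exp x \<otimes> monoid_list_prod G as \<and>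
     (\<forall>i. Suc i < length as \<longrightarrow> \<one> gcdof\<^bsub>submon\<^esub> (inv (as ! i) \<otimes> \<delta>) (as ! Suc i))"

definition normal_form :: "'a \<Rightarrow> 'a list" where
  "normal_form x = (THE as. is_normal_form x as)"

definition cycling :: "'a \<Rightarrow> 'a" where
  "cycling x =
     (if canonical_length x = 0 then x
      else conjugate x (tau_pow (- inf_exp x) (hd (normal_form x))))"

definition conjugates :: "'a \<Rightarrow> 'a set" where
  "conjugates x = {conjugate x c | c. c \<in> carrier G}"

definition super_summit_set :: "'a \<Rightarrow> 'a set" where
  "super_summit_set x =
     {y \<in> conjugates x. \<forall>w\<in>conjugates x. inf_exp w \<le> inf_exp y \<and> sup_exp y \<le> sup_exp w}"

definition ultra_summit_set :: "'a \<Rightarrow> 'a set" where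
  "ultra_summit_set x = {y \<in> super_summit_set x. \<exists>k>0. (cycling ^^ k) y = y}"

end

end

theory Submission
  imports Defs
begin

text \<open>
  Let \<open>k = inf y\<close>. Cycling is always conjugation by \<open>\<iota>(y) = y \<delta>\<^sup>-\<^sup>k \<and> \<delta>\<close>. If \<open>y\<close> and \<open>y\<^sup>s\<close> lie in the super
  summit set, then \<open>\<iota>(y)\<inverse> s \<iota>(y\<^sup>s) = \<iota>(y)\<inverse> (y s \<delta>\<^sup>-\<^sup>k \<and> s \<delta>)\<close> conjugates \<open>c(y)\<close> to \<open>c(y\<^sup>s)\<close>. The
  right-hand side shows that this transport of \<open>s\<close> preserves gcds and powers of \<open>\<delta>\<close>. On the
  ultra summit set it acts injectively on finite sets, hence periodically; therefore \<open>y\<^sup>s \<in> U\<^sub>x\<close> with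
  \<open>s \<in> M\<close> implies \<open>y\<^bsup>s \<and> \<delta>\<^esup> \<in> U\<^sub>x\<close>, and splitting off \<open>s \<and> \<delta>\<close> repeatedly factors \<open>s\<close> into simple
  elements that stay in \<open>U\<^sub>x\<close>. The conjugator from \<open>y\<close> to \<open>z\<close> can be taken in \<open>M\<close>, because conjugation
  by \<open>\<delta>\<close> permutes the finite set \<open>U\<^sub>x\<close> and thus some large power of \<open>\<delta>\<close> commutes with \<open>z\<close>.
\<close>

subsection \<open>Periodic points\<close>

lemma funpow_in:
  assumes "f ` A \<subseteq> A" "a \<in> A"
  shows "(f ^^ n) a \<in> A"
  using assms by (induction n) auto

text \<open>The orbit of \<open>a\<close> stays in a finite set, so two iterates coincide. Every
  iterate of \<open>f\<close> is injective on \<open>A\<close>, which cancels the earlier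
  one.\<close>

lemma finite_inj_on_periodic:
  assumes "finite A" "f ` A \<subseteq> A" "inj_on f A" "a \<in> A"
  shows "\<exists>n>0. (f ^^ n) a = a"
proof -
  have inj: "inj_on (f ^^ n) A" for n
  proof (induction n)
    case (Suc n)
    have "(f ^^ n) ` A \<subseteq> A"
      using funpow_in[OF assms(2)] by auto
    with Suc assms(3) have "inj_on (f \<circ> f ^^ n) A"
      by (meson comp_inj_on inj_on_subset)
    then show ?case by (simp add: comp_def)
  qed simp
  have "\<not> inj (\<lambda>n. (f ^^ n) a)"
  proof
    assume "inj (\<lambda>n. (f ^^ n) a)"
    moreover have "range (\<lambda>n. (f ^^ n) a) \<subseteq> A"
      using funpow_in[OF assms(2,4)] by auto
    ultimately show False
      using assms(1) finite_subset infinite_iff_countable_subset by blast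
  qed
  then obtain i j where "i < j" "(f ^^ i) a = (f ^^ j) a"
    unfolding inj_def by (metis nat_neq_iff)
  then have "(f ^^ i) a = (f ^^ i) ((f ^^ (j - i)) a)"
    by (metis comp_apply funpow_add le_add_diff_inverse less_imp_le)
  then have "(f ^^ (j - i)) a = a"
    using inj_onD[OF inj] funpow_in[OF assms(2,4)] assms(4) by metis
  with \<open>i < j\<close> show ?thesis by (intro exI[of _ "j - i"]) simp
qed

lemma funpow_fixed_mult:
  assumes "(f ^^ m) a = a"
  shows "(f ^^ (m * n)) a = a"
  using assms by (induction n) (simp_all add: funpow_add)

text \<open>Two periodic points have a common period \<open>m * n = Suc l\<close>, and
  \<open>f ^^ l\<close> recovers each of them from its image.\<close>

lemma inj_on_periodic: "inj_on f {a. \<exists>n>0. (f ^^ n) a = a}"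
proof (rule inj_onI, clarsimp)
  fix a b m n :: nat and x y
  assume *: "f x = f y" "0 < m" "(f ^^ m) x = x" "0 < n" "(f ^^ n) y = y"
  then obtain l where l: "m * n = Suc l"
    by (metis Suc_pred nat_0_less_mult_iff)
  have "(f ^^ (m * n)) x = x" "(f ^^ (m * n)) y = y"
    using *(3,5) funpow_fixed_mult[of m f x n] funpow_fixed_mult[of n f y m]
    by (simp_all add: mult.commute)
  then show "x = y"
    using *(1) unfolding l funpow_Suc_right by simp
qed

context group
begin

lemma inv_cancel_left [simp]:
  "\<lbrakk>x \<in> carrier G; y \<in> carrier G\<rbrakk> \<Longrightarrow> inv x \<otimes> (x \<otimes> y) = y"
  "\<lbrakk>x \<in> carrier G; y \<in> carrier G\<rbrakk> \<Longrightarrow> x \<otimes> (inv x \<otimes> y) = y"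
  by (simp_all flip: m_assoc)

end

subsection \<open>The Garside monoid\<close>

context garside_group
begin

notation prefix_le (infix "\<preceq>" 50)

abbreviation dpow :: "int \<Rightarrow> 'a" where
  "dpow i \<equiv> \<delta> [^] i"

lemma M_subset: "M \<subseteq> carrier G"
  and M_mult [simp]: "\<lbrakk>a \<in> M; b \<in> M\<rbrakk> \<Longrightarrow> a \<otimes> b \<in> M"
  and M_one [simp]: "\<one> \<in> M"
  using submonoid by (auto simp: submonoid_def)

lemma M_carrier [simp]: "a \<in> M \<Longrightarrow> a \<in> carrier G"
  using M_subset by blast

lemma
  shows gm_atomic: "atomic_monoid submon"
    and gm_garside: "garside_element submon \<delta>"
    and gm_gcd: "\<lbrakk>a \<in> M; b \<in> M\<rbrakk> \<Longrightarrow> \<exists>d\<in>M. d gcdof\<^bsub>submon\<^esub> a b"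
  using garside_monoid.atomic[OF garside_monoid] garside_monoid.garside_element[OF garside_monoid]
    garside_monoid.gcd_exists[OF garside_monoid]
  by auto

lemma delta_M [simp]: "\<delta> \<in> M"
  using gm_garside by (simp add: garside_element_def)

lemma divides_submon: "\<lbrakk>a \<in> M; b \<in> M\<rbrakk> \<Longrightarrow> a divides\<^bsub>submon\<^esub> b \<longleftrightarrow> a \<preceq> b"
  unfolding factor_def prefix_le_def
  by (auto intro!: bexI[of _ "inv a \<otimes> b"])

lemma rdivides_submon: "\<lbrakk>a \<in> M; b \<in> M\<rbrakk> \<Longrightarrow> rdivides submon a b \<longleftrightarrow> b \<otimes> inv a \<in> M"
  unfolding rdivides_def
  by (auto simp: m_assoc intro!: bexI[of _ "b \<otimes> inv a"])

lemma simples_iff: "a \<in> simples \<longleftrightarrow> a \<in> M \<and> a \<preceq> \<delta>"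
  unfolding simples_def using divides_submon delta_M by blast

lemma simples_iff_right: "a \<in> simples \<longleftrightarrow> a \<in> M \<and> \<delta> \<otimes> inv a \<in> M"
proof -
  have "a \<in> simples \<longleftrightarrow> a \<in> M \<and> rdivides submon a \<delta>"
    using gm_garside unfolding simples_def garside_element_def by auto
  then show ?thesis
    using rdivides_submon delta_M by blast
qed

lemma finite_simples: "finite simples"
  using gm_garside unfolding simples_def garside_element_def by (elim conjE) simp

lemma monoid_list_prod_submon: "monoid_list_prod submon as = monoid_list_prod G as"
  by (simp add: monoid_list_prod_def)

lemma monoid_list_prod_simps [simp]:
  "monoid_list_prod G [] = \<one>"
  "monoid_list_prod G (a # as) = a \<otimes> monoid_list_prod G as"
  by (simp_all add: monoid_list_prod_def)

lemma monoid_list_prod_closed: "set as \<subseteq> M \<Longrightarrow> monoid_list_prod G as \<in> M"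
  by (induction as) auto

lemma monoid_list_prod_append:
  "\<lbrakk>set as \<subseteq> M; set bs \<subseteq> M\<rbrakk> \<Longrightarrow>
    monoid_list_prod G (as @ bs) = monoid_list_prod G as \<otimes> monoid_list_prod G bs"
  by (induction as) (auto simp: m_assoc monoid_list_prod_closed)

lemma generates_submonD:
  assumes "generates_monoid submon A" "a \<in> M"
  shows "\<exists>as. a = monoid_list_prod G as \<and> set as \<subseteq> A"
proof -
  have "a \<in> carrier submon" using assms(2) by simp
  then show ?thesis
    unfolding assms(1)[unfolded generates_monoid_def] monoid_list_prod_submon by blast
qed

lemma M_induct [consumes 1, case_names one mult]:
  assumes "a \<in> M" "P \<one>" "\<And>s b. \<lbrakk>s \<in> simples; b \<in> M; P b\<rbrakk> \<Longrightarrow> P (s \<otimes> b)"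
  shows "P a"
proof -
  have "generates_monoid submon simples"
    using gm_garside unfolding simples_def garside_element_def by (elim conjE) simp
  then obtain as where as: "a = monoid_list_prod G as" "set as \<subseteq> simples"
    using generates_submonD assms(1) by blast
  have "set as \<subseteq> M"
    using as(2) by (auto simp: simples_iff)
  then have "P (monoid_list_prod G as)"
    using as(2) by (induction as) (auto simp: assms monoid_list_prod_closed)
  then show ?thesis by (simp add: as(1))
qed

text \<open>The bound on the number of atoms in a factorization of \<open>\<one>\<close> leaves no nontrivial units.\<close>

lemma M_inv_imp_one:
  assumes "a \<in> M" "inv a \<in> M"
  shows "a = \<one>"
proof -
  let ?A = "{x. monoid_atom submon x}"
  have AM: "?A \<subseteq> M"
    by (auto simp: monoid_atom_def)
  have "generates_monoid submon ?A"
    using gm_atomic by (simp add: atomic_monoid_def)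
  then obtain as bs where as: "a = monoid_list_prod G as" "set as \<subseteq> ?A"
    and bs: "inv a = monoid_list_prod G bs" "set bs \<subseteq> ?A"
    using generates_submonD assms by metis
  have asM: "set as \<subseteq> M" and bsM: "set bs \<subseteq> M"
    using as bs AM by auto
  obtain N where N: "\<And>cs. \<lbrakk>set cs \<subseteq> ?A; monoid_list_prod G cs = \<one>\<rbrakk> \<Longrightarrow> length cs \<le> N"
  proof -
    have "\<one> \<in> carrier submon" by simp
    then obtain N where "\<forall>cs. (\<forall>x\<in>set cs. monoid_atom submon x) \<and> monoid_list_prod G cs = \<one> \<longrightarrow>
        length cs \<le> N"
      using gm_atomic unfolding atomic_monoid_def monoid_list_prod_submon by blast
    then show thesis by (intro that[of N]) blast
  qed
  define es where "es = as @ bs"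
  have es: "set es \<subseteq> ?A" "set es \<subseteq> M"
    using as(2) bs(2) asM bsM by (auto simp: es_def)
  have "monoid_list_prod G es = a \<otimes> inv a"
    unfolding es_def monoid_list_prod_append[OF asM bsM] by (simp only: as(1)[symmetric] bs(1)[symmetric])
  then have prod_es: "monoid_list_prod G es = \<one>"
    using assms(1) by simp
  \<comment> \<open>If \<open>es\<close> were nonempty, repeating it \<open>Suc N\<close> times
    would give a factorization of \<open>\<one>\<close> into more than \<open>N\<close>
    atoms.\<close>
  let ?c = "\<lambda>n. concat (replicate n es)"
  have sub: "set (?c n) \<subseteq> set es" for n
    by (induction n) auto
  have "monoid_list_prod G (?c n) = \<one>" for n
  proof (induction n)
    case (Suc n)
    have "set (?c n) \<subseteq> M"
      using sub es(2) by (rule subset_trans)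
    then have "monoid_list_prod G (es @ ?c n) = monoid_list_prod G es \<otimes> monoid_list_prod G (?c n)"
      by (rule monoid_list_prod_append[OF es(2)])
    with Suc show ?case by (simp add: prod_es)
  qed simp
  then have "length (?c (Suc N)) \<le> N"
    using N sub es(1) by (meson subset_trans)
  moreover have "length (?c n) = n * length es" for n
    by (induction n) auto
  ultimately have "Suc N * length es \<le> N"
    by metis
  then have "length es = 0"
    by (cases "length es") auto
  then have "as = []" by (simp add: es_def)
  then show ?thesis using as(1) by simp
qed

subsection \<open>The prefix order of the group of fractions\<close>

lemma prefix_refl [simp]: "a \<in> carrier G \<Longrightarrow> a \<preceq> a"
  by (simp add: prefix_le_def)

lemma prefix_trans:
  assumes "a \<preceq> b" "b \<preceq> c" "a \<in> carrier G" "b \<in> carrier G" "c \<in> carrier G"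
  shows "a \<preceq> c"
proof -
  have "(inv a \<otimes> b) \<otimes> (inv b \<otimes> c) \<in> M"
    using assms by (auto simp: prefix_le_def)
  then show ?thesis
    using assms by (simp add: prefix_le_def m_assoc)
qed

lemma prefix_antisym:
  assumes "a \<preceq> b" "b \<preceq> a" "a \<in> carrier G" "b \<in> carrier G"
  shows "a = b"
proof -
  have "inv a \<otimes> b = \<one>"
    using assms by (intro M_inv_imp_one) (simp_all add: prefix_le_def inv_mult_group)
  then show ?thesis
    using assms by (metis inv_solve_left' r_one one_closed)
qed

lemma prefix_mult_left [simp]:
  "\<lbrakk>g \<in> carrier G; a \<in> carrier G; b \<in> carrier G\<rbrakk> \<Longrightarrow> g \<otimes> a \<preceq> g \<otimes> b \<longleftrightarrow> a \<preceq> b"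
  by (simp add: prefix_le_def inv_mult_group m_assoc)

lemma one_prefix [simp]: "a \<in> carrier G \<Longrightarrow> \<one> \<preceq> a \<longleftrightarrow> a \<in> M"
  by (simp add: prefix_le_def)

lemma prefix_mult_M: "\<lbrakk>a \<in> carrier G; b \<in> M\<rbrakk> \<Longrightarrow> a \<preceq> a \<otimes> b"
  by (simp add: prefix_le_def)

section \<open>Powers of the Garside element\<close>

lemma dpow_mult: "dpow i \<otimes> dpow j = dpow (i + j)"
  by (simp add: int_pow_mult)

lemma dpow_mult_assoc: "a \<in> carrier G \<Longrightarrow> dpow i \<otimes> (dpow j \<otimes> a) = dpow (i + j) \<otimes> a"
  by (simp add: int_pow_mult m_assoc)

lemma inv_dpow: "inv (dpow i) = dpow (- i)"
  by (simp add: int_pow_neg)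

lemmas dpow_simps = dpow_mult dpow_mult_assoc inv_dpow m_assoc inv_mult_group

text \<open>For a simple \<open>s\<close>, the complement
  \<open>u = inv s \<otimes> \<delta>\<close> is a suffix of \<open>\<delta>\<close>, hence also a
  prefix. Its own complement \<open>inv u \<otimes> \<delta>\<close> is the conjugate of
  \<open>s\<close> by \<open>\<delta>\<close>, which therefore lies in \<open>M\<close>; simple
  elements generate the rest.\<close>

lemma M_conj_delta:
  assumes "a \<in> M"
  shows "inv \<delta> \<otimes> a \<otimes> \<delta> \<in> M"
  using assms
proof (induction rule: M_induct)
  case (mult s b)
  have s: "s \<in> M" using mult by (simp add: simples_iff)
  define u where "u = inv s \<otimes> \<delta>"
  have "\<delta> \<otimes> inv u = s" and uM: "u \<in> M"
    using mult s by (auto simp: u_def inv_mult_group simples_iff prefix_le_def m_assoc)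
  then have "u \<in> simples"
    using s by (simp add: simples_iff_right)
  then have "inv u \<otimes> \<delta> \<in> M"
    by (simp add: simples_iff prefix_le_def)
  moreover have "inv u \<otimes> \<delta> = inv \<delta> \<otimes> s \<otimes> \<delta>"
    using s by (simp add: u_def inv_mult_group m_assoc)
  ultimately have "(inv \<delta> \<otimes> s \<otimes> \<delta>) \<otimes> (inv \<delta> \<otimes> b \<otimes> \<delta>) \<in> M"
    using mult by simp
  then show ?case
    using s mult by (simp add: m_assoc)
qed simp

lemma M_conj_inv_delta:
  assumes "a \<in> M"
  shows "\<delta> \<otimes> a \<otimes> inv \<delta> \<in> M"
  using assms
proof (induction rule: M_induct)
  case (mult s b)
  have s: "s \<in> M" using mult by (simp add: simples_iff)
  define u where "u = \<delta> \<otimes> inv s"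
  have "inv u \<otimes> \<delta> = s" and uM: "u \<in> M"
    using mult s by (auto simp: u_def inv_mult_group simples_iff_right m_assoc)
  then have "u \<in> simples"
    using s by (simp add: simples_iff prefix_le_def)
  then have "\<delta> \<otimes> inv u \<in> M"
    by (simp add: simples_iff_right)
  moreover have "\<delta> \<otimes> inv u = \<delta> \<otimes> s \<otimes> inv \<delta>"
    using s by (simp add: u_def inv_mult_group m_assoc)
  ultimately have "(\<delta> \<otimes> s \<otimes> inv \<delta>) \<otimes> (\<delta> \<otimes> b \<otimes> inv \<delta>) \<in> M"
    using mult by simp
  then show ?case
    using s mult by (simp add: m_assoc)
qed simp

lemma M_conj_dpow_M:
  assumes "a \<in> M"
  shows "dpow (- i) \<otimes> a \<otimes> dpow i \<in> M"
proof (induction i rule: int_induct[of _ 0])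
  case base
  then show ?case using assms by simp
next
  case (step1 i)
  have "inv \<delta> \<otimes> (dpow (- i) \<otimes> a \<otimes> dpow i) \<otimes> \<delta> \<in> M"
    using step1 by (intro M_conj_delta)
  \<comment> \<open>\<open>\<delta>\<close> is written as \<open>dpow 1\<close> so that
    \<open>dpow_simps\<close> can collect all exponents; \<open>int_pow_1\<close> would undo
    this.\<close>
  then have "dpow (-1) \<otimes> (dpow (- i) \<otimes> a \<otimes> dpow i) \<otimes> dpow 1 \<in> M"
    by (simp add: int_pow_neg)
  then show ?case
    using assms by (simp add: dpow_simps algebra_simps del: int_pow_1)
next
  case (step2 i)
  have "\<delta> \<otimes> (dpow (- i) \<otimes> a \<otimes> dpow i) \<otimes> inv \<delta> \<in> M"
    using step2 by (intro M_conj_inv_delta)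
  then have "dpow 1 \<otimes> (dpow (- i) \<otimes> a \<otimes> dpow i) \<otimes> dpow (-1) \<in> M"
    by (simp add: int_pow_neg)
  then show ?case
    using assms by (simp add: dpow_simps del: int_pow_1)
qed

lemma M_conj_dpow [simp]:
  assumes "a \<in> carrier G"
  shows "dpow (- i) \<otimes> (a \<otimes> dpow i) \<in> M \<longleftrightarrow> a \<in> M"
proof
  assume "dpow (- i) \<otimes> (a \<otimes> dpow i) \<in> M"
  then have "dpow (- (- i)) \<otimes> (dpow (- i) \<otimes> (a \<otimes> dpow i)) \<otimes> dpow (- i) \<in> M"
    by (rule M_conj_dpow_M)
  then show "a \<in> M"
    using assms by (simp add: dpow_simps)
next
  assume "a \<in> M"
  then show "dpow (- i) \<otimes> (a \<otimes> dpow i) \<in> M"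
    using M_conj_dpow_M[of a i] by (simp add: m_assoc)
qed

text \<open>The prefix order is invariant under left multiplication. On the right, powers of
  \<open>\<delta>\<close> are harmless because conjugation by them maps \<open>M\<close> onto
  itself.\<close>

lemma prefix_mult_dpow [simp]:
  assumes "a \<in> carrier G" "b \<in> carrier G"
  shows "a \<otimes> dpow i \<preceq> b \<otimes> dpow i \<longleftrightarrow> a \<preceq> b"
  using M_conj_dpow[of "inv a \<otimes> b" i] assms
  by (simp add: prefix_le_def dpow_simps)

lemma dpow_nonneg_M: "0 \<le> i \<Longrightarrow> dpow i \<in> M"
proof (induction i rule: int_ge_induct)
  case (step i)
  then have "dpow i \<otimes> \<delta> \<in> M" by simp
  then show ?case by (simp add: int_pow_mult)
qed simp

lemma dpow_mono: "i \<le> j \<Longrightarrow> dpow i \<preceq> dpow j"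
  by (simp add: prefix_le_def dpow_simps dpow_nonneg_M)

text \<open>If \<open>i > j\<close>, multiplying \<open>dpow (j - i)\<close> by the element
  \<open>dpow (i - j - 1)\<close> of \<open>M\<close> puts \<open>inv \<delta>\<close> into
  \<open>M\<close>, so \<open>\<delta>\<close> would be a nontrivial unit.\<close>

lemma dpow_prefix_iff: "\<delta> \<noteq> \<one> \<Longrightarrow> dpow i \<preceq> dpow j \<longleftrightarrow> i \<le> j"
proof (rule iffI, rule ccontr)
  assume *: "\<delta> \<noteq> \<one>" "dpow i \<preceq> dpow j" "\<not> i \<le> j"
  then have "dpow (i - j - 1) \<in> M" "dpow (j - i) \<in> M"
    by (auto simp: prefix_le_def dpow_simps intro!: dpow_nonneg_M)
  then have "dpow (i - j - 1) \<otimes> dpow (j - i) \<in> M" by simp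
  then have "inv \<delta> \<in> M" by (simp add: dpow_mult int_pow_neg)
  with * show False using M_inv_imp_one delta_M by metis
qed (rule dpow_mono)

text \<open>A product of \<open>n\<close> simple elements is a prefix of \<open>dpow n\<close>:
  replace the factors by \<open>\<delta>\<close> one at a time, moving \<open>\<preceq>\<close> past
  a power of \<open>\<delta>\<close> on the right.\<close>

lemma M_prefix_dpow:
  assumes "a \<in> M"
  shows "\<exists>n\<ge>0. a \<preceq> dpow n"
  using assms
proof (induction rule: M_induct)
  case one
  then show ?case by (intro exI[of _ 0]) simp
next
  case (mult s b)
  then obtain n where n: "n \<ge> 0" "b \<preceq> dpow n" by blast
  have s: "s \<in> M" "s \<preceq> dpow 1" using mult by (simp_all add: simples_iff)
  have "s \<otimes> b \<preceq> s \<otimes> dpow n" "s \<otimes> dpow n \<preceq> dpow 1 \<otimes> dpow n"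
    using s n mult by (simp_all del: int_pow_1)
  then have "s \<otimes> b \<preceq> dpow (1 + n)"
    using s mult by (metis dpow_mult M_carrier delta_M int_pow_closed m_closed prefix_trans)
  with n show ?case by (intro exI[of _ "1 + n"]) simp
qed

text \<open>A high power of \<open>\<delta>\<close> absorbs the denominator of a fraction. The claim
  covers all large exponents, so that the exponent can be adapted to further requirements.\<close>

lemma eventually_mult_dpow_M:
  assumes "g \<in> carrier G"
  shows "\<exists>n\<ge>0. \<forall>m\<ge>n. g \<otimes> dpow m \<in> M"
proof -
  obtain a b where ab: "a \<in> M" "b \<in> M" "g = a \<otimes> inv b"
    using assms fractions by auto
  obtain n where n: "n \<ge> 0" "b \<preceq> dpow n" using M_prefix_dpow ab by blast
  have "g \<otimes> dpow m \<in> M" if "m \<ge> n" for m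
  proof -
    have "b \<preceq> dpow m"
      using n(2) dpow_mono[OF that] ab by (rule_tac prefix_trans[of b "dpow n"]) auto
    then have "a \<otimes> (inv b \<otimes> dpow m) \<in> M"
      using ab by (simp add: prefix_le_def)
    then show ?thesis using ab by (simp add: m_assoc)
  qed
  with n show ?thesis by blast
qed

lemma eventually_dpow_mult_M:
  assumes "g \<in> carrier G"
  shows "\<exists>n\<ge>0. \<forall>m\<ge>n. dpow m \<otimes> g \<in> M"
proof -
  have "dpow m \<otimes> g \<in> M" if "g \<otimes> dpow m \<in> M" for m
    using M_conj_dpow[of "dpow m \<otimes> g" m] that assms by (simp add: dpow_simps)
  then show ?thesis
    using eventually_mult_dpow_M[OF assms] by blast
qed

subsection \<open>Left gcds\<close>

definition is_lgcd :: "'a \<Rightarrow> 'a \<Rightarrow> 'a \<Rightarrow> bool" where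
  "is_lgcd d a b \<longleftrightarrow> d \<in> carrier G \<and> d \<preceq> a \<and> d \<preceq> b \<and>
     (\<forall>e\<in>carrier G. e \<preceq> a \<and> e \<preceq> b \<longrightarrow> e \<preceq> d)"

definition lgcd :: "'a \<Rightarrow> 'a \<Rightarrow> 'a" where
  "lgcd a b = (THE d. is_lgcd d a b)"

lemma is_lgcd_unique:
  "\<lbrakk>is_lgcd d a b; is_lgcd e a b\<rbrakk> \<Longrightarrow> d = e"
  by (simp add: is_lgcd_def prefix_antisym)

lemma gcdof_submon:
  "\<lbrakk>d \<in> M; a \<in> M; b \<in> M\<rbrakk> \<Longrightarrow> d gcdof\<^bsub>submon\<^esub> a b \<longleftrightarrow>
     d \<preceq> a \<and> d \<preceq> b \<and> (\<forall>e\<in>M. e \<preceq> a \<and> e \<preceq> b \<longrightarrow> e \<preceq> d)"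
  unfolding isgcd_def by (auto simp: divides_submon)

text \<open>
  The gcd of \<open>M\<close> competes with lower bounds in \<open>M\<close> only; multiplying by a power of \<open>\<delta>\<close> brings an
  arbitrary lower bound into \<open>M\<close>.
\<close>

lemma is_lgcd_M:
  assumes "d \<in> M" "a \<in> M" "b \<in> M" "d gcdof\<^bsub>submon\<^esub> a b"
  shows "is_lgcd d a b"
proof -
  have d: "d \<preceq> a" "d \<preceq> b" "\<And>e. \<lbrakk>e \<in> M; e \<preceq> a; e \<preceq> b\<rbrakk> \<Longrightarrow> e \<preceq> d"
    using assms by (auto simp: gcdof_submon)
  have "e \<preceq> d" if e: "e \<in> carrier G" "e \<preceq> a" "e \<preceq> b" for e
  proof -
    obtain n where n: "n \<ge> 0" "dpow n \<otimes> e \<in> M"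
      using eventually_dpow_mult_M[OF e(1)] by blast
    have nM: "dpow n \<in> M" using n dpow_nonneg_M by blast
    obtain f where f: "f \<in> M" "f gcdof\<^bsub>submon\<^esub> (dpow n \<otimes> a) (dpow n \<otimes> b)"
      using gm_gcd[of "dpow n \<otimes> a" "dpow n \<otimes> b"] nM assms by auto
    have f': "f \<preceq> dpow n \<otimes> a" "f \<preceq> dpow n \<otimes> b"
      "\<And>g. \<lbrakk>g \<in> M; g \<preceq> dpow n \<otimes> a; g \<preceq> dpow n \<otimes> b\<rbrakk> \<Longrightarrow> g \<preceq> f"
      using f nM assms by (auto simp: gcdof_submon)
    \<comment> \<open>The common prefix \<open>dpow n\<close> can be cancelled from
      \<open>f\<close>. The quotient is a lower bound of \<open>a\<close> and \<open>b\<close>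
      inside \<open>M\<close>, hence below \<open>d\<close>, and it lies above
      \<open>e\<close>.\<close>
    have "dpow n \<preceq> f" using nM assms by (intro f') (auto intro: prefix_mult_M)
    then have fM: "dpow (- n) \<otimes> f \<in> M" by (simp add: prefix_le_def inv_dpow)
    have "dpow (- n) \<otimes> f \<preceq> dpow (- n) \<otimes> (dpow n \<otimes> a)"
      "dpow (- n) \<otimes> f \<preceq> dpow (- n) \<otimes> (dpow n \<otimes> b)"
      using f' f assms by simp_all
    then have "dpow (- n) \<otimes> f \<preceq> a" "dpow (- n) \<otimes> f \<preceq> b"
      using assms by (simp_all add: dpow_simps)
    then have "dpow (- n) \<otimes> f \<preceq> d" using fM d by blast
    moreover have "dpow n \<otimes> e \<preceq> f" using n e assms by (intro f') auto
    then have "dpow (- n) \<otimes> (dpow n \<otimes> e) \<preceq> dpow (- n) \<otimes> f"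
      using f e by (subst prefix_mult_left) auto
    then have "e \<preceq> dpow (- n) \<otimes> f" using e by (simp add: dpow_simps)
    ultimately show ?thesis
      using prefix_trans[of e "dpow (- n) \<otimes> f" d] e f assms by simp
  qed
  with d assms show ?thesis by (auto simp: is_lgcd_def)
qed

lemma is_lgcd_mult_left:
  assumes "is_lgcd d a b" "g \<in> carrier G" "a \<in> carrier G" "b \<in> carrier G"
  shows "is_lgcd (g \<otimes> d) (g \<otimes> a) (g \<otimes> b)"
proof -
  have "e \<preceq> g \<otimes> d" if e: "e \<in> carrier G" "e \<preceq> g \<otimes> a" "e \<preceq> g \<otimes> b" for e
  proof -
    have "inv g \<otimes> e \<preceq> inv g \<otimes> (g \<otimes> a)" "inv g \<otimes> e \<preceq> inv g \<otimes> (g \<otimes> b)"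
      using e assms by (auto simp del: inv_cancel_left)
    then have "inv g \<otimes> e \<preceq> d"
      using e assms by (auto simp: is_lgcd_def)
    then have "g \<otimes> (inv g \<otimes> e) \<preceq> g \<otimes> d"
      using e assms by (subst prefix_mult_left) (auto simp: is_lgcd_def)
    then show ?thesis using e assms by simp
  qed
  then show ?thesis using assms by (auto simp: is_lgcd_def)
qed

lemma is_lgcd_mult_dpow:
  assumes "is_lgcd d a b" "a \<in> carrier G" "b \<in> carrier G"
  shows "is_lgcd (d \<otimes> dpow i) (a \<otimes> dpow i) (b \<otimes> dpow i)"
proof -
  have "e \<preceq> d \<otimes> dpow i" if e: "e \<in> carrier G" "e \<preceq> a \<otimes> dpow i" "e \<preceq> b \<otimes> dpow i" for e
  proof -
    have eq: "e = (e \<otimes> dpow (- i)) \<otimes> dpow i"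
      using e by (simp add: dpow_simps)
    then have "e \<otimes> dpow (- i) \<preceq> a" "e \<otimes> dpow (- i) \<preceq> b"
      using e assms prefix_mult_dpow[of "e \<otimes> dpow (- i)" _ i] by (simp_all flip: eq)
    then have "e \<otimes> dpow (- i) \<preceq> d"
      using e assms by (auto simp: is_lgcd_def)
    then show ?thesis
      using e assms by (subst eq, subst prefix_mult_dpow) (auto simp: is_lgcd_def)
  qed
  then show ?thesis using assms by (auto simp: is_lgcd_def)
qed

text \<open>One power of \<open>\<delta>\<close> moves both elements into \<open>M\<close>, where a
  gcd exists; left invariance of the order moves it back.\<close>

lemma is_lgcd_lgcd:
  assumes "a \<in> carrier G" "b \<in> carrier G"
  shows "is_lgcd (lgcd a b) a b"
proof -
  obtain m where "\<forall>i\<ge>m. dpow i \<otimes> a \<in> M"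
    using eventually_dpow_mult_M[OF assms(1)] by blast
  moreover obtain n where "\<forall>i\<ge>n. dpow i \<otimes> b \<in> M"
    using eventually_dpow_mult_M[OF assms(2)] by blast
  ultimately have "dpow (max m n) \<otimes> a \<in> M" "dpow (max m n) \<otimes> b \<in> M" by auto
  then obtain d where "is_lgcd d (dpow (max m n) \<otimes> a) (dpow (max m n) \<otimes> b)"
    using gm_gcd is_lgcd_M by blast
  then have "is_lgcd (dpow (- max m n) \<otimes> d) (dpow (- max m n) \<otimes> (dpow (max m n) \<otimes> a))
      (dpow (- max m n) \<otimes> (dpow (max m n) \<otimes> b))"
    using assms by (intro is_lgcd_mult_left) auto
  then have "is_lgcd (dpow (- max m n) \<otimes> d) a b"
    using assms by (simp add: dpow_simps)
  then show ?thesis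
    using theI[of "\<lambda>d. is_lgcd d a b"] is_lgcd_unique unfolding lgcd_def by blast
qed

lemma lgcd_eqI: "\<lbrakk>is_lgcd d a b; a \<in> carrier G; b \<in> carrier G\<rbrakk> \<Longrightarrow> lgcd a b = d"
  using is_lgcd_lgcd is_lgcd_unique by blast

lemma
  assumes "a \<in> carrier G" "b \<in> carrier G"
  shows lgcd_closed [simp]: "lgcd a b \<in> carrier G"
    and lgcd_prefix1 [simp]: "lgcd a b \<preceq> a"
    and lgcd_prefix2 [simp]: "lgcd a b \<preceq> b"
    and lgcd_greatest: "\<lbrakk>e \<in> carrier G; e \<preceq> a; e \<preceq> b\<rbrakk> \<Longrightarrow> e \<preceq> lgcd a b"
  using is_lgcd_lgcd[OF assms] by (auto simp: is_lgcd_def)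

lemma lgcd_mult_left:
  "\<lbrakk>g \<in> carrier G; a \<in> carrier G; b \<in> carrier G\<rbrakk> \<Longrightarrow> lgcd (g \<otimes> a) (g \<otimes> b) = g \<otimes> lgcd a b"
  by (intro lgcd_eqI is_lgcd_mult_left is_lgcd_lgcd) auto

lemma lgcd_mult_dpow:
  "\<lbrakk>a \<in> carrier G; b \<in> carrier G\<rbrakk> \<Longrightarrow>
    lgcd (a \<otimes> dpow i) (b \<otimes> dpow i) = lgcd a b \<otimes> dpow i"
  by (intro lgcd_eqI is_lgcd_mult_dpow is_lgcd_lgcd) auto

lemma lgcd_M: "\<lbrakk>a \<in> M; b \<in> M\<rbrakk> \<Longrightarrow> lgcd a b \<in> M"
  using lgcd_greatest[of a b \<one>] by simp

lemma lgcd_lgcd_distrib: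
  assumes "a \<in> carrier G" "b \<in> carrier G" "c \<in> carrier G" "d \<in> carrier G"
  shows "lgcd (lgcd a b) (lgcd c d) = lgcd (lgcd a c) (lgcd b d)"
proof -
  have "lgcd (lgcd p q) (lgcd r s) \<preceq> lgcd (lgcd p r) (lgcd q s)"
    if "p \<in> carrier G" "q \<in> carrier G" "r \<in> carrier G" "s \<in> carrier G" for p q r s
  proof -
    let ?l = "lgcd (lgcd p q) (lgcd r s)"
    have "?l \<preceq> lgcd p q" "?l \<preceq> lgcd r s"
      "lgcd p q \<preceq> p" "lgcd p q \<preceq> q" "lgcd r s \<preceq> r" "lgcd r s \<preceq> s"
      using that by simp_all
    then have "?l \<preceq> p" "?l \<preceq> q" "?l \<preceq> r" "?l \<preceq> s"
      using prefix_trans[of ?l "lgcd p q"] prefix_trans[of ?l "lgcd r s"] that by simp_all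
    then show ?thesis
      using that by (simp add: lgcd_greatest)
  qed
  then show ?thesis
    using assms by (rule_tac prefix_antisym) auto
qed

text \<open>Both \<open>a \<otimes> dpow i\<close> and \<open>\<delta> \<otimes> dpow i\<close> have
  the prefix \<open>a\<close>, and their gcd is \<open>lgcd a \<delta> \<otimes> dpow i\<close>.
  Splitting off the greatest simple prefix thus lowers the exponent by one, which drives all later
  inductions on exponents.\<close>

lemma prefix_lgcd_dpow:
  assumes "a \<in> carrier G" "a \<preceq> dpow (i + 1)" "i \<ge> 0"
  shows "inv (lgcd a \<delta>) \<otimes> a \<preceq> dpow i"
proof -
  have "a \<preceq> lgcd (a \<otimes> dpow i) (\<delta> \<otimes> dpow i)"
    using assms by (intro lgcd_greatest) (auto simp: prefix_mult_M dpow_nonneg_M int_pow_mult add.commute)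
  also have "lgcd (a \<otimes> dpow i) (\<delta> \<otimes> dpow i) = lgcd a \<delta> \<otimes> dpow i"
    using assms by (simp add: lgcd_mult_dpow)
  finally have "inv (lgcd a \<delta>) \<otimes> a \<preceq> inv (lgcd a \<delta>) \<otimes> (lgcd a \<delta> \<otimes> dpow i)"
    using assms by (subst prefix_mult_left) auto
  then show ?thesis using assms by simp
qed

lemma finite_prefix_dpow: "finite {a \<in> M. a \<preceq> dpow (int n)}"
proof (induction n)
  case 0
  have "{a \<in> M. a \<preceq> dpow (int 0)} \<subseteq> {\<one>}"
    by (auto intro: prefix_antisym)
  then show ?case using finite_subset by blast
next
  case (Suc n)
  have "{a \<in> M. a \<preceq> dpow (int (Suc n))} \<subseteq>
    (\<lambda>(s, b). s \<otimes> b) ` (simples \<times> {a \<in> M. a \<preceq> dpow (int n)})"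
  proof clarify
    fix a assume a: "a \<in> M" "a \<preceq> dpow (int (Suc n))"
    have "a = lgcd a \<delta> \<otimes> (inv (lgcd a \<delta>) \<otimes> a)"
      using a by simp
    moreover have "lgcd a \<delta> \<in> simples"
      using a by (simp add: simples_iff lgcd_M)
    moreover have "inv (lgcd a \<delta>) \<otimes> a \<in> M"
      using a lgcd_prefix1[of a \<delta>] by (simp add: prefix_le_def)
    moreover have "inv (lgcd a \<delta>) \<otimes> a \<preceq> dpow (int n)"
      using a prefix_lgcd_dpow[of a "int n"] by (simp add: add.commute)
    ultimately show "a \<in> (\<lambda>(s, b). s \<otimes> b) ` (simples \<times> {a \<in> M. a \<preceq> dpow (int n)})"
      by (intro image_eqI[of _ _ "(lgcd a \<delta>, inv (lgcd a \<delta>) \<otimes> a)"]) auto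
  qed
  then show ?case
    using Suc finite_simples by (meson finite_SigmaI finite_imageI finite_subset)
qed

subsection \<open>Normal forms and cycling\<close>

definition initial_factor :: "'a \<Rightarrow> 'a" where
  "initial_factor y = lgcd (y \<otimes> dpow (- inf_exp y)) \<delta>"

definition transport :: "'a \<Rightarrow> 'a \<Rightarrow> 'a" where
  "transport y s = inv (initial_factor y) \<otimes> s \<otimes> initial_factor (conjugate y s)"

abbreviation left_weighted :: "'a \<Rightarrow> 'a \<Rightarrow> bool" where
  "left_weighted a b \<equiv> lgcd (inv a \<otimes> \<delta>) b = \<one>"

lemma prefix_one_iff: "a \<in> M \<Longrightarrow> a \<preceq> \<one> \<longleftrightarrow> a = \<one>"
  using prefix_antisym[of a \<one>] by auto

lemma simples_M: "a \<in> simples \<Longrightarrow> a \<in> M"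
  by (simp add: simples_iff)

lemma simple_complement_M: "a \<in> simples \<Longrightarrow> inv a \<otimes> \<delta> \<in> M"
  by (simp add: simples_iff prefix_le_def)

lemma lgcd_simple: "a \<in> M \<Longrightarrow> lgcd a \<delta> \<in> simples"
  by (simp add: simples_iff lgcd_M)

lemma lgcd_cofactor_M: "a \<in> M \<Longrightarrow> inv (lgcd a \<delta>) \<otimes> a \<in> M"
  using lgcd_prefix1[of a \<delta>] by (simp add: prefix_le_def)

lemma gcdof_one_iff:
  assumes "a \<in> M" "b \<in> M"
  shows "\<one> gcdof\<^bsub>submon\<^esub> a b \<longleftrightarrow> lgcd a b = \<one>"
proof
  assume "\<one> gcdof\<^bsub>submon\<^esub> a b"
  then show "lgcd a b = \<one>"
    using assms by (intro lgcd_eqI is_lgcd_M) simp_all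
next
  assume "lgcd a b = \<one>"
  then show "\<one> gcdof\<^bsub>submon\<^esub> a b"
    using assms lgcd_greatest[of a b] by (simp add: gcdof_submon)
qed

lemma is_normal_form_iff:
  "is_normal_form x as \<longleftrightarrow> set as \<subseteq> simples \<and> int (length as) = canonical_length x \<and>
     x = dpow (inf_exp x) \<otimes> monoid_list_prod G as \<and> successively left_weighted as"
proof -
  have "\<one> gcdof\<^bsub>submon\<^esub> (inv (as ! i) \<otimes> \<delta>) (as ! Suc i) \<longleftrightarrow>
      left_weighted (as ! i) (as ! Suc i)" if "set as \<subseteq> simples" "Suc i < length as" for i
  proof -
    have "as ! i \<in> simples" "as ! Suc i \<in> simples"
      using that by (meson nth_mem Suc_lessD subsetD)+
    then show ?thesis
      by (intro gcdof_one_iff simple_complement_M simples_M)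
  qed
  then show ?thesis
    unfolding is_normal_form_def successively_conv_nth by blast
qed

section \<open>Uniqueness and existence of left-weighted factorizations\<close>

text \<open>By left invariance \<open>lgcd (a \<otimes> b) \<delta>\<close> is
  \<open>a \<otimes> d\<close> with \<open>d\<close> the gcd of \<open>b\<close> and the complement
  of \<open>a\<close>. That complement is itself a prefix of \<open>\<delta>\<close>, so
  \<open>d\<close> is a prefix of \<open>lgcd b \<delta>\<close> and left-weightedness forces
  \<open>d = \<one>\<close>.\<close>

lemma left_weighted_lgcd:
  assumes "a \<in> simples" "b \<in> M" "left_weighted a (lgcd b \<delta>)"
  shows "lgcd (a \<otimes> b) \<delta> = a"
proof -
  have aM: "a \<in> M" and bM: "inv a \<otimes> \<delta> \<in> M"
    using assms simples_M simple_complement_M by auto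
  define d where "d = lgcd b (inv a \<otimes> \<delta>)"
  have dM: "d \<in> M" using assms bM by (simp add: d_def lgcd_M)
  have d: "d \<preceq> b" "d \<preceq> inv a \<otimes> \<delta>"
    using assms aM by (simp_all add: d_def)
  have "inv a \<otimes> \<delta> \<preceq> \<delta>"
    using M_conj_delta[OF aM] aM by (simp add: prefix_le_def inv_mult_group m_assoc)
  then have "d \<preceq> \<delta>"
    using prefix_trans[OF d(2)] dM aM by simp
  then have "d \<preceq> lgcd b \<delta>"
    using d dM assms by (simp add: lgcd_greatest)
  then have "d \<preceq> lgcd (inv a \<otimes> \<delta>) (lgcd b \<delta>)"
    using d dM aM assms by (rule_tac lgcd_greatest) simp_all
  then have "d = \<one>"
    using assms(3) dM by (simp add: prefix_one_iff)
  moreover have "lgcd (a \<otimes> b) (a \<otimes> (inv a \<otimes> \<delta>)) = a \<otimes> d"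
    unfolding d_def using aM assms by (intro lgcd_mult_left) simp_all
  ultimately show ?thesis using aM by simp
qed

text \<open>A condition on neighbouring entries determines a global gcd: by induction the tail has
  its own head as greatest simple prefix, so only the first two entries matter. Hence the product
  determines the head.\<close>

lemma lgcd_normal_list:
  assumes "set (a # as) \<subseteq> simples" "successively left_weighted (a # as)"
  shows "lgcd (a \<otimes> monoid_list_prod G as) \<delta> = a"
  using assms
proof (induction as arbitrary: a)
  case Nil
  have "lgcd \<one> \<delta> = \<one>"
    by (rule lgcd_eqI) (auto simp: is_lgcd_def)
  moreover have "lgcd (inv a \<otimes> \<delta>) \<one> = \<one>"
    using Nil simple_complement_M[of a] simples_M[of a] by (intro lgcd_eqI) (auto simp: is_lgcd_def)
  ultimately show ?case
    using Nil by (intro left_weighted_lgcd) auto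
next
  case (Cons b as)
  have "set as \<subseteq> M" using Cons.prems simples_M by auto
  then show ?case
    using Cons by (intro left_weighted_lgcd) (auto simp: simples_M monoid_list_prod_closed)
qed

text \<open>Trailing entries \<open>\<one>\<close> keep a list left-weighted, so the product fixes
  the list only once the length is given.\<close>

lemma normal_list_unique:
  assumes "length as = length bs" "set as \<subseteq> simples" "set bs \<subseteq> simples"
    "successively left_weighted as" "successively left_weighted bs"
    "monoid_list_prod G as = monoid_list_prod G bs"
  shows "as = bs"
  using assms
proof (induction as bs rule: list_induct2)
  case (Cons a as b bs)
  have M: "set as \<subseteq> M" "set bs \<subseteq> M" "a \<in> M" "b \<in> M"
    using Cons.prems simples_M by auto
  have "a = b"
    using lgcd_normal_list[of a as] lgcd_normal_list[of b bs] Cons.prems by simp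
  moreover have "monoid_list_prod G as = monoid_list_prod G bs"
    using Cons.prems(5) M monoid_list_prod_closed by (simp add: \<open>a = b\<close>)
  moreover have "successively left_weighted as" "successively left_weighted bs"
    using Cons.prems(3,4) by (auto simp: successively_Cons)
  ultimately show ?case
    using Cons.IH Cons.prems(1,2) by simp
qed simp

text \<open>The greedy choice \<open>lgcd p \<delta>\<close> is repeated exactly \<open>n\<close>
  times; once \<open>p\<close> is used up, the remaining entries are \<open>\<one>\<close>.\<close>

lemma normal_list_exists:
  assumes "p \<in> M" "p \<preceq> dpow (int n)"
  shows "\<exists>as. length as = n \<and> set as \<subseteq> simples \<and> successively left_weighted as \<and>
    monoid_list_prod G as = p"
  using assms
proof (induction n arbitrary: p)
  case 0
  then show ?case by (simp add: prefix_one_iff)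
next
  case (Suc n)
  define a where "a = lgcd p \<delta>"
  define q where "q = inv a \<otimes> p"
  have a: "a \<in> simples" "a \<in> M" and q: "q \<in> M" and p: "p = a \<otimes> q"
    using Suc.prems(1) lgcd_cofactor_M[of p]
    by (simp_all add: a_def q_def lgcd_simple simples_M lgcd_M)
  have "q \<preceq> dpow (int n)"
    using prefix_lgcd_dpow[of p "int n"] Suc.prems by (simp add: q_def a_def add.commute)
  with Suc.IH q obtain as where as: "length as = n" "set as \<subseteq> simples"
    "successively left_weighted as" "monoid_list_prod G as = q"
    by blast
  have "left_weighted a (hd as)" if ne: "as \<noteq> []"
  proof -
    obtain b bs where bs: "as = b # bs" using ne by (cases as) auto
    have bM: "b \<in> M" "monoid_list_prod G bs \<in> M"
      using as bs simples_M by (auto intro!: monoid_list_prod_closed)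
    define e where "e = lgcd (inv a \<otimes> \<delta>) b"
    have eM: "e \<in> M"
      using a bM simple_complement_M by (simp add: e_def lgcd_M)
    have "e \<preceq> b" "e \<preceq> inv a \<otimes> \<delta>"
      using a bM by (simp_all add: e_def)
    moreover have "b \<preceq> q"
      using as bs bM by (auto intro: prefix_mult_M)
    ultimately have "e \<preceq> q" "e \<preceq> inv a \<otimes> \<delta>"
      using prefix_trans[of e b q] eM bM q by auto
    then have "a \<otimes> e \<preceq> a \<otimes> q" "a \<otimes> e \<preceq> a \<otimes> (inv a \<otimes> \<delta>)"
      using a eM q by (simp_all del: inv_cancel_left)
    \<comment> \<open>A nontrivial \<open>e\<close> would make \<open>a \<otimes> e\<close> a common
      prefix of \<open>p\<close> and \<open>\<delta>\<close> beyond their gcd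
      \<open>a\<close>.\<close>
    then have "a \<otimes> e \<preceq> lgcd p \<delta>"
      using a eM q by (intro lgcd_greatest) (simp_all add: p)
    then have "a \<otimes> e \<preceq> a \<otimes> \<one>"
      using a by (simp flip: a_def)
    then have "e \<preceq> \<one>"
      using a eM by (subst (asm) prefix_mult_left) auto
    then show ?thesis
      using eM by (simp add: prefix_one_iff e_def bs)
  qed
  then have "successively left_weighted (a # as)"
    using as by (auto simp: successively_Cons)
  then show ?case
    using as a p by (intro exI[of _ "a # as"]) simp
qed

lemma conjugate_closed [simp]:
  "\<lbrakk>y \<in> carrier G; c \<in> carrier G\<rbrakk> \<Longrightarrow> conjugate y c \<in> carrier G"
  by (simp add: conjugate_def)

lemma conjugate_conjugate:
  "\<lbrakk>y \<in> carrier G; a \<in> carrier G; b \<in> carrier G\<rbrakk> \<Longrightarrow>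
    conjugate (conjugate y a) b = conjugate y (a \<otimes> b)"
  by (simp add: conjugate_def inv_mult_group m_assoc)

lemma conjugate_one [simp]: "y \<in> carrier G \<Longrightarrow> conjugate y \<one> = y"
  by (simp add: conjugate_def)

lemma conjugates_closed: "\<lbrakk>x \<in> carrier G; y \<in> conjugates x\<rbrakk> \<Longrightarrow> y \<in> carrier G"
  by (auto simp: conjugates_def)

lemma conjugate_in_conjugates:
  assumes "x \<in> carrier G" "y \<in> conjugates x" "c \<in> carrier G"
  shows "conjugate y c \<in> conjugates x"
  using assms unfolding conjugates_def by (auto simp: conjugate_conjugate intro: m_closed)

lemma prefix_conjugate_iff:
  assumes "y \<in> carrier G" "r \<in> carrier G" "d \<in> carrier G"
  shows "d \<preceq> conjugate y r \<longleftrightarrow> r \<otimes> d \<preceq> y \<otimes> r"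
    and "conjugate y r \<preceq> d \<longleftrightarrow> y \<otimes> r \<preceq> r \<otimes> d"
  using prefix_mult_left[of r d "conjugate y r"] prefix_mult_left[of r "conjugate y r" d] assms
  by (simp_all add: conjugate_def m_assoc)

section \<open>Infimum, supremum and cycling for a nontrivial Garside element\<close>

context
  assumes delta_ne_one: "\<delta> \<noteq> \<one>"
begin

text \<open>Since \<open>g\<close> is a prefix of some \<open>dpow u\<close>, the exponents of
  powers below \<open>g\<close> are bounded by \<open>u\<close>; this uses
  \<open>\<delta> \<noteq> \<one>\<close>. So the greatest exponent exists and is the maximum over a
  finite interval.\<close>

lemma dpow_prefix_iff_inf_exp:
  assumes "g \<in> carrier G"
  shows "dpow j \<preceq> g \<longleftrightarrow> j \<le> inf_exp g"
proof -
  obtain l where "dpow l \<otimes> g \<in> M"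
    using eventually_dpow_mult_M[OF assms] by blast
  then have l: "dpow (- l) \<preceq> g"
    by (simp add: prefix_le_def inv_dpow)
  obtain u where "inv g \<otimes> dpow u \<in> M"
    using eventually_mult_dpow_M[of "inv g"] assms by auto
  then have u: "g \<preceq> dpow u"
    by (simp add: prefix_le_def)
  have bound: "i \<le> u" if "dpow i \<preceq> g" for i
    using prefix_trans[OF that u] assms dpow_prefix_iff[OF delta_ne_one] by simp
  define m where "m = Max {i \<in> {- l..u}. dpow i \<preceq> g}"
  have "- l \<in> {i \<in> {- l..u}. dpow i \<preceq> g}" using l bound by auto
  then have m: "m \<in> {i \<in> {- l..u}. dpow i \<preceq> g}"
    unfolding m_def by (intro Max_in finite_Collect_conjI) auto
  have max: "i \<le> m" if "dpow i \<preceq> g" for i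
  proof (cases "- l \<le> i")
    case True
    then show ?thesis
      unfolding m_def using that bound by (intro Max_ge finite_Collect_conjI) auto
  next
    case False
    then show ?thesis using m by auto
  qed
  have "inf_exp g = m"
    unfolding inf_exp_def using m max by (intro Greatest_equality) auto
  moreover have "dpow j \<preceq> g" if "j \<le> m"
    using prefix_trans[OF dpow_mono[OF that]] m assms by simp
  ultimately show ?thesis using max by blast
qed

text \<open>Inversion reverses the comparison with powers of \<open>\<delta>\<close>, so the
  supremum of \<open>g\<close> is minus the infimum of \<open>inv g\<close>.\<close>

lemma prefix_dpow_iff_sup_exp:
  assumes "g \<in> carrier G"
  shows "g \<preceq> dpow j \<longleftrightarrow> sup_exp g \<le> j"
proof -
  have inv_iff: "g \<preceq> dpow i \<longleftrightarrow> dpow (- i) \<preceq> inv g" for i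
    using M_conj_dpow[of "dpow i \<otimes> inv g" i] assms
    by (simp add: prefix_le_def dpow_simps)
  have "sup_exp g = - inf_exp (inv g)"
    unfolding sup_exp_def inv_iff using assms
    by (intro Least_equality) (auto simp: dpow_prefix_iff_inf_exp)
  then show ?thesis
    unfolding inv_iff using assms by (auto simp: dpow_prefix_iff_inf_exp)
qed

lemma inf_exp_prefix: "y \<in> carrier G \<Longrightarrow> dpow (inf_exp y) \<preceq> y"
  by (simp add: dpow_prefix_iff_inf_exp)

lemma prefix_sup_exp: "y \<in> carrier G \<Longrightarrow> y \<preceq> dpow (sup_exp y)"
  by (simp add: prefix_dpow_iff_sup_exp)

lemma inf_exp_le_sup_exp: "y \<in> carrier G \<Longrightarrow> inf_exp y \<le> sup_exp y"
  using prefix_trans[OF inf_exp_prefix prefix_sup_exp] dpow_prefix_iff[OF delta_ne_one] by simp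

text \<open>Removing \<open>dpow (inf_exp y)\<close> leaves an element between \<open>\<one>\<close>
  and the power of \<open>\<delta>\<close> with exponent \<open>canonical_length y\<close>. Its
  greedy factorization of that length is the only one.\<close>

lemma is_normal_form_normal_form:
  assumes "y \<in> carrier G"
  shows "is_normal_form y (normal_form y)"
proof -
  define p where "p = dpow (- inf_exp y) \<otimes> y"
  have y: "y = dpow (inf_exp y) \<otimes> p"
    using assms by (simp add: p_def dpow_simps)
  have pM: "p \<in> M"
    using inf_exp_prefix[OF assms] by (simp add: p_def prefix_le_def inv_dpow)
  have "dpow (- inf_exp y) \<otimes> y \<preceq> dpow (- inf_exp y) \<otimes> dpow (sup_exp y)"
    using prefix_sup_exp[OF assms] assms by simp
  then have "p \<preceq> dpow (int (nat (canonical_length y)))"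
    using inf_exp_le_sup_exp[OF assms] by (simp add: p_def canonical_length_def dpow_mult)
  from normal_list_exists[OF pM this]
  obtain as where as: "length as = nat (canonical_length y)" "set as \<subseteq> simples"
    "successively left_weighted as" "monoid_list_prod G as = p"
    by blast
  have "is_normal_form y as"
    using as y inf_exp_le_sup_exp[OF assms] by (simp add: is_normal_form_iff canonical_length_def)
  moreover have "bs = as" if bs: "is_normal_form y bs" for bs
  proof (rule normal_list_unique)
    have bs': "set bs \<subseteq> simples" "int (length bs) = canonical_length y"
      "y = dpow (inf_exp y) \<otimes> monoid_list_prod G bs" "successively left_weighted bs"
      using bs by (simp_all only: is_normal_form_iff)
    show "length bs = length as" using bs' as by simp
    show "set bs \<subseteq> simples" "set as \<subseteq> simples" "successively left_weighted bs"
      "successively left_weighted as"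
      using bs' as by auto
    have "monoid_list_prod G bs \<in> M"
      using bs' simples_M by (intro monoid_list_prod_closed) auto
    moreover have "dpow (inf_exp y) \<otimes> monoid_list_prod G bs = dpow (inf_exp y) \<otimes> p"
      using bs'(3) y by metis
    ultimately show "monoid_list_prod G bs = monoid_list_prod G as"
      using pM as(4) by simp
  qed
  ultimately show ?thesis
    unfolding normal_form_def by (rule theI)
qed

lemma initial_factor_closed [simp]: "y \<in> carrier G \<Longrightarrow> initial_factor y \<in> carrier G"
  by (simp add: initial_factor_def)

text \<open>In length zero \<open>y\<close> is a power of \<open>\<delta>\<close> and the gcd is
  trivial. Otherwise the first factor is \<open>lgcd p \<delta>\<close>; multiplying by
  \<open>dpow k\<close> on the left and \<open>dpow (- k)\<close> on the right, with
  \<open>k = inf_exp y\<close>, turns it into \<open>initial_factor y\<close> and fixes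
  \<open>\<delta>\<close>.\<close>

lemma cycling_eq:
  assumes "y \<in> carrier G"
  shows "cycling y = conjugate y (initial_factor y)"
proof (cases "canonical_length y = 0")
  case True
  then have "sup_exp y = inf_exp y" by (simp add: canonical_length_def)
  then have y: "y = dpow (inf_exp y)"
    using prefix_antisym[of y "dpow (inf_exp y)"] inf_exp_prefix[of y] prefix_sup_exp[of y] assms
    by simp
  have "y \<otimes> dpow (- inf_exp y) = \<one>"
    by (subst y) (simp add: dpow_mult)
  moreover have "lgcd \<one> \<delta> = \<one>"
    by (rule lgcd_eqI) (auto simp: is_lgcd_def)
  ultimately have "initial_factor y = \<one>" by (simp add: initial_factor_def)
  then show ?thesis using True assms by (simp add: cycling_def)
next
  case False
  let ?k = "inf_exp y"
  note nf = is_normal_form_normal_form[OF assms, unfolded is_normal_form_iff]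
  then obtain a as where as: "normal_form y = a # as"
    using False by (cases "normal_form y") auto
  have M: "a \<in> M" "monoid_list_prod G as \<in> M"
    using nf as simples_M by (auto intro!: monoid_list_prod_closed)
  define p where "p = a \<otimes> monoid_list_prod G as"
  have p: "p \<in> carrier G" "y = dpow ?k \<otimes> p"
    using nf M by (simp_all add: p_def as)
  have lp: "lgcd p \<delta> = a"
    unfolding p_def using nf as by (intro lgcd_normal_list) auto
  have "y \<otimes> dpow (- ?k) = dpow ?k \<otimes> p \<otimes> dpow (- ?k)"
    using arg_cong[OF p(2), of "\<lambda>g. g \<otimes> dpow (- ?k)"] .
  moreover have "\<delta> = dpow ?k \<otimes> dpow 1 \<otimes> dpow (- ?k)"
    by (simp add: dpow_mult del: int_pow_1) simp
  ultimately have "initial_factor y =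
      lgcd (dpow ?k \<otimes> p \<otimes> dpow (- ?k)) (dpow ?k \<otimes> dpow 1 \<otimes> dpow (- ?k))"
    by (simp only: initial_factor_def)
  also have "\<dots> = dpow ?k \<otimes> lgcd p \<delta> \<otimes> dpow (- ?k)"
    using p(1) by (simp add: lgcd_mult_dpow lgcd_mult_left)
  also have "\<dots> = tau_pow (- ?k) a"
    using M by (simp add: tau_pow_def conjugate_def lp dpow_simps)
  finally show ?thesis
    using False by (simp add: cycling_def as)
qed

lemma cycling_closed [simp]: "y \<in> carrier G \<Longrightarrow> cycling y \<in> carrier G"
  by (simp add: cycling_eq)

subsection \<open>Transport\<close>

lemma transport_closed [simp]:
  "\<lbrakk>y \<in> carrier G; s \<in> carrier G\<rbrakk> \<Longrightarrow> transport y s \<in> carrier G"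
  by (simp add: transport_def)

lemma conjugate_cycling_transport:
  assumes "y \<in> carrier G" "s \<in> carrier G"
  shows "conjugate (cycling y) (transport y s) = cycling (conjugate y s)"
  using assms by (simp add: cycling_eq transport_def conjugate_conjugate m_assoc)

text \<open>Because \<open>s \<otimes> conjugate y s = y \<otimes> s\<close>, the factor
  \<open>s\<close> can be moved into the gcd. Equal infima give both initial factors the same
  exponent. In the result \<open>s\<close> meets only multiplications that distribute over
  gcds.\<close>

lemma transport_eq:
  assumes "y \<in> carrier G" "s \<in> carrier G" "inf_exp (conjugate y s) = inf_exp y"
  shows "transport y s = inv (initial_factor y) \<otimes> lgcd (y \<otimes> s \<otimes> dpow (- inf_exp y)) (s \<otimes> \<delta>)"
proof -
  have "s \<otimes> initial_factor (conjugate y s) =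
      lgcd (s \<otimes> (conjugate y s \<otimes> dpow (- inf_exp y))) (s \<otimes> \<delta>)"
    using assms by (simp add: initial_factor_def lgcd_mult_left)
  also have "s \<otimes> (conjugate y s \<otimes> dpow (- inf_exp y)) = y \<otimes> s \<otimes> dpow (- inf_exp y)"
    using assms by (simp add: conjugate_def m_assoc)
  finally show ?thesis
    using assms by (simp add: transport_def m_assoc)
qed

lemma transport_dpow:
  assumes "y \<in> carrier G" "inf_exp (conjugate y (dpow n)) = inf_exp y"
  shows "transport y (dpow n) = dpow n"
proof -
  have "y \<otimes> dpow n \<otimes> dpow (- inf_exp y) = (y \<otimes> dpow (- inf_exp y)) \<otimes> dpow n"
    using assms by (simp add: dpow_simps add.commute)
  moreover have "dpow n \<otimes> \<delta> = \<delta> \<otimes> dpow n"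
    using dpow_mult[of n 1] dpow_mult[of 1 n] by (simp add: add.commute)
  ultimately have "lgcd (y \<otimes> dpow n \<otimes> dpow (- inf_exp y)) (dpow n \<otimes> \<delta>) =
      initial_factor y \<otimes> dpow n"
    using assms by (simp add: lgcd_mult_dpow initial_factor_def)
  then show ?thesis
    using assms by (simp add: transport_eq)
qed

lemma transport_lgcd:
  assumes "y \<in> carrier G" "s \<in> carrier G" "t \<in> carrier G"
    "inf_exp (conjugate y s) = inf_exp y" "inf_exp (conjugate y t) = inf_exp y"
    "inf_exp (conjugate y (lgcd s t)) = inf_exp y"
  shows "transport y (lgcd s t) = lgcd (transport y s) (transport y t)"
proof -
  let ?k = "- inf_exp y"
  have "lgcd (y \<otimes> lgcd s t \<otimes> dpow ?k) (lgcd s t \<otimes> dpow 1) =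
      lgcd (lgcd (y \<otimes> s \<otimes> dpow ?k) (y \<otimes> t \<otimes> dpow ?k)) (lgcd (s \<otimes> dpow 1) (t \<otimes> dpow 1))"
    using assms by (simp add: lgcd_mult_dpow lgcd_mult_left del: int_pow_1)
  also have "\<dots> = lgcd (lgcd (y \<otimes> s \<otimes> dpow ?k) (s \<otimes> dpow 1)) (lgcd (y \<otimes> t \<otimes> dpow ?k) (t \<otimes> dpow 1))"
    using assms by (intro lgcd_lgcd_distrib) simp_all
  finally show ?thesis
    using assms by (simp add: transport_eq lgcd_mult_left)
qed

subsection \<open>Super summit and ultra summit sets\<close>

context
  fixes x :: 'a
  assumes x: "x \<in> carrier G"
begin

abbreviation "S \<equiv> super_summit_set x"
abbreviation "U \<equiv> ultra_summit_set x"

lemma S_closed: "y \<in> S \<Longrightarrow> y \<in> carrier G"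
  using conjugates_closed[OF x] by (simp add: super_summit_set_def)

lemma inf_exp_S:
  assumes "y \<in> S" "w \<in> S"
  shows "inf_exp w = inf_exp y"
  using assms by (auto simp: super_summit_set_def intro!: antisym)

lemma S_iff:
  assumes "y \<in> S"
  shows "w \<in> S \<longleftrightarrow> w \<in> conjugates x \<and> dpow (inf_exp y) \<preceq> w \<and> w \<preceq> dpow (sup_exp y)"
proof -
  have "w \<in> S \<longleftrightarrow> w \<in> conjugates x \<and> inf_exp y \<le> inf_exp w \<and> sup_exp w \<le> sup_exp y"
    using assms unfolding super_summit_set_def by (auto intro: order_trans)
  then show ?thesis
    using conjugates_closed[OF x]
    by (auto simp: dpow_prefix_iff_inf_exp prefix_dpow_iff_sup_exp)
qed

text \<open>Clearing the inverse of \<open>c\<close> leaves comparisons between products of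
  \<open>c\<close> with \<open>y\<close> or powers of \<open>\<delta>\<close>, all of which commute
  with gcds.\<close>

lemma conjugate_in_S_iff:
  assumes "y \<in> S" "c \<in> carrier G"
  shows "conjugate y c \<in> S \<longleftrightarrow>
    c \<otimes> dpow (inf_exp y) \<preceq> y \<otimes> c \<and> y \<otimes> c \<preceq> c \<otimes> dpow (sup_exp y)"
  using assms S_iff[OF assms(1)] S_closed[OF assms(1)] conjugate_in_conjugates[OF x]
  by (simp add: prefix_conjugate_iff super_summit_set_def)

lemma S_prefix:
  assumes "y \<in> S"
  shows "dpow (inf_exp y) \<preceq> y" "y \<preceq> dpow (sup_exp y)"
  using S_iff[OF assms, of y] assms by auto

lemma finite_S: "finite S"
proof (cases "S = {}")
  case False
  then obtain y where y: "y \<in> S" by blast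
  let ?k = "inf_exp y" and ?n = "nat (sup_exp y - inf_exp y)"
  have "S \<subseteq> (\<otimes>) (dpow ?k) ` {a \<in> M. a \<preceq> dpow (int ?n)}"
  proof
    fix w assume w: "w \<in> S"
    then have wG: "w \<in> carrier G" by (rule S_closed)
    have k: "dpow ?k \<preceq> w" "w \<preceq> dpow (sup_exp y)"
      using S_iff[OF y] w by auto
    then have "dpow (- ?k) \<otimes> w \<preceq> dpow (- ?k) \<otimes> dpow (sup_exp y)"
      using wG by simp
    then have "dpow (- ?k) \<otimes> w \<preceq> dpow (int ?n)"
      using inf_exp_le_sup_exp[OF S_closed[OF y]] by (simp add: dpow_mult)
    moreover have "dpow (- ?k) \<otimes> w \<in> M"
      using k by (simp add: prefix_le_def inv_dpow)
    moreover have "w = dpow ?k \<otimes> (dpow (- ?k) \<otimes> w)"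
      using wG by (simp add: dpow_simps)
    ultimately show "w \<in> (\<otimes>) (dpow ?k) ` {a \<in> M. a \<preceq> dpow (int ?n)}"
      by blast
  qed
  then show ?thesis
    using finite_prefix_dpow finite_subset by blast
qed simp

lemma conjugate_dpow_in_S:
  assumes "y \<in> S"
  shows "conjugate y (dpow n) \<in> S"
proof -
  have "dpow (inf_exp y) \<otimes> dpow n \<preceq> y \<otimes> dpow n" "y \<otimes> dpow n \<preceq> dpow (sup_exp y) \<otimes> dpow n"
    using S_prefix[OF assms] S_closed[OF assms] by simp_all
  then show ?thesis
    using assms by (simp add: conjugate_in_S_iff dpow_mult add.commute)
qed

text \<open>For \<open>r = lgcd s t\<close>, each lower side belonging to \<open>r\<close> is below
  the upper sides belonging to \<open>s\<close> and to \<open>t\<close>, hence below their gcd,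
  which is the upper side belonging to \<open>r\<close>.\<close>

lemma conjugate_lgcd_in_S:
  assumes "y \<in> S" "s \<in> carrier G" "t \<in> carrier G" "conjugate y s \<in> S" "conjugate y t \<in> S"
  shows "conjugate y (lgcd s t) \<in> S"
proof -
  have y: "y \<in> carrier G" using assms S_closed by blast
  let ?k = "dpow (inf_exp y)" and ?m = "dpow (sup_exp y)" and ?r = "lgcd s t"
  have st: "s \<otimes> ?k \<preceq> y \<otimes> s" "y \<otimes> s \<preceq> s \<otimes> ?m" "t \<otimes> ?k \<preceq> y \<otimes> t" "y \<otimes> t \<preceq> t \<otimes> ?m"
    using assms by (simp_all add: conjugate_in_S_iff)
  have r: "?r \<otimes> ?k \<preceq> s \<otimes> ?k" "?r \<otimes> ?k \<preceq> t \<otimes> ?k" "y \<otimes> ?r \<preceq> y \<otimes> s" "y \<otimes> ?r \<preceq> y \<otimes> t"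
    using assms y by simp_all
  have "?r \<otimes> ?k \<preceq> y \<otimes> s" "?r \<otimes> ?k \<preceq> y \<otimes> t" "y \<otimes> ?r \<preceq> s \<otimes> ?m" "y \<otimes> ?r \<preceq> t \<otimes> ?m"
    using prefix_trans[OF r(1) st(1)] prefix_trans[OF r(2) st(3)]
      prefix_trans[OF r(3) st(2)] prefix_trans[OF r(4) st(4)] assms y by simp_all
  then have "?r \<otimes> ?k \<preceq> lgcd (y \<otimes> s) (y \<otimes> t)" "y \<otimes> ?r \<preceq> lgcd (s \<otimes> ?m) (t \<otimes> ?m)"
    using assms y by (simp_all add: lgcd_greatest)
  then show ?thesis
    using assms y by (simp add: conjugate_in_S_iff lgcd_mult_left lgcd_mult_dpow)
qed

text \<open>Write \<open>i\<close> for the initial factor, \<open>k\<close> and \<open>m\<close> for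
  the infimum and supremum. The infimum is kept since
  \<open>i \<otimes> dpow k \<preceq> y \<preceq> y \<otimes> i\<close>. For the supremum,
  \<open>y \<otimes> i\<close> is below both \<open>y \<otimes> dpow (m - k)\<close> and
  \<open>dpow (1 + m)\<close>, whose gcd is \<open>i \<otimes> dpow m\<close>; the first bound needs
  \<open>m - k \<ge> 1\<close>.\<close>

lemma cycling_in_S:
  assumes "y \<in> S"
  shows "cycling y \<in> S"
proof (cases "canonical_length y = 0")
  case True
  then show ?thesis using assms by (simp add: cycling_def)
next
  case False
  have y: "y \<in> carrier G" using assms S_closed by blast
  let ?k = "inf_exp y" and ?m = "sup_exp y" and ?i = "initial_factor y"
  note pre = S_prefix[OF assms]
  have km: "1 \<le> ?m - ?k"
    using False inf_exp_le_sup_exp[OF y] by (simp add: canonical_length_def)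
  have ik: "?i \<preceq> y \<otimes> dpow (- ?k)" "?i \<preceq> \<delta>"
    using y by (simp_all add: initial_factor_def)
  have "dpow ?k \<otimes> dpow (- ?k) \<preceq> y \<otimes> dpow (- ?k)"
    using pre y prefix_mult_dpow by simp
  then have "y \<otimes> dpow (- ?k) \<in> M"
    using y by (simp add: dpow_mult)
  then have iM: "?i \<in> M"
    by (simp add: initial_factor_def lgcd_M)
  have "?i \<otimes> dpow ?k \<preceq> (y \<otimes> dpow (- ?k)) \<otimes> dpow ?k"
    using ik y iM by (subst prefix_mult_dpow) auto
  then have "?i \<otimes> dpow ?k \<preceq> y"
    using y by (simp add: dpow_simps)
  then have 1: "?i \<otimes> dpow ?k \<preceq> y \<otimes> ?i"
    using prefix_trans[of "?i \<otimes> dpow ?k" y "y \<otimes> ?i"] prefix_mult_M y iM by simp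
  have "?i \<preceq> dpow (?m - ?k)"
    using prefix_trans[of ?i \<delta> "dpow (?m - ?k)"] ik(2) dpow_mono[OF km] y iM by simp
  then have "y \<otimes> ?i \<preceq> y \<otimes> dpow (?m - ?k)" "y \<otimes> ?i \<preceq> y \<otimes> dpow 1"
    using y iM ik by simp_all
  moreover have "y \<otimes> dpow 1 \<preceq> dpow ?m \<otimes> dpow 1"
    using y pre prefix_mult_dpow[of y "dpow ?m" 1] by (simp del: int_pow_1)
  then have "y \<otimes> ?i \<preceq> dpow ?m \<otimes> dpow 1"
    using prefix_trans[OF calculation(2)] y iM by simp
  ultimately have "y \<otimes> ?i \<preceq> lgcd (y \<otimes> dpow (?m - ?k)) (dpow (1 + ?m))"
    using y iM by (intro lgcd_greatest) (simp_all add: dpow_mult add.commute del: int_pow_1)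
  also have "lgcd (y \<otimes> dpow (?m - ?k)) (dpow (1 + ?m)) = ?i \<otimes> dpow ?m"
    using y lgcd_mult_dpow[of "y \<otimes> dpow (- ?k)" "dpow 1" ?m]
    by (simp add: initial_factor_def dpow_simps del: int_pow_1) simp
  finally have "y \<otimes> ?i \<preceq> ?i \<otimes> dpow ?m" .
  with 1 show ?thesis
    using assms y iM by (simp add: cycling_eq conjugate_in_S_iff)
qed

text \<open>Preserving gcds makes transport monotone, and it fixes powers of
  \<open>\<delta>\<close>, so the bounds \<open>\<one> \<preceq> s \<preceq> dpow n\<close> are
  carried over. This keeps transports in a finite set.\<close>

lemma transport_in_M:
  assumes "y \<in> S" "conjugate y s \<in> S" "s \<in> M" "s \<preceq> dpow n"
  shows "transport y s \<in> M" "transport y s \<preceq> dpow n"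
proof -
  have y: "y \<in> carrier G" using assms S_closed by blast
  have *: "transport y a \<preceq> transport y b"
    if "a \<in> carrier G" "b \<in> carrier G" "a \<preceq> b" "conjugate y a \<in> S" "conjugate y b \<in> S" for a b
  proof -
    have "lgcd a b = a"
      using that by (intro lgcd_eqI) (auto simp: is_lgcd_def)
    moreover have "inf_exp (conjugate y a) = inf_exp y" "inf_exp (conjugate y b) = inf_exp y"
      using that assms(1) inf_exp_S by blast+
    ultimately have "transport y a = lgcd (transport y a) (transport y b)"
      using transport_lgcd[OF y that(1,2)] by simp
    then show ?thesis
      using lgcd_prefix2[of "transport y a" "transport y b"] that y by simp
  qed
  have "inf_exp (conjugate y (dpow i)) = inf_exp y" for i
    using conjugate_dpow_in_S assms(1) inf_exp_S by blast
  then have dp: "transport y (dpow i) = dpow i" for i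
    using transport_dpow[OF y] by blast
  have "transport y (dpow 0) \<preceq> transport y s" "transport y s \<preceq> transport y (dpow n)"
    using assms y by (intro *; simp add: conjugate_dpow_in_S)+
  then show "transport y s \<in> M" "transport y s \<preceq> dpow n"
    using y assms unfolding dp by simp_all
qed

section \<open>Closure properties of the ultra summit set\<close>

lemma U_subset_S: "U \<subseteq> S"
  by (auto simp: ultra_summit_set_def)

lemma finite_U: "finite U"
  using finite_S U_subset_S finite_subset by blast

lemma U_closed: "y \<in> U \<Longrightarrow> y \<in> carrier G"
  using U_subset_S S_closed by blast

lemma U_I: "\<lbrakk>y \<in> S; (cycling ^^ n) y = y; n > 0\<rbrakk> \<Longrightarrow> y \<in> U"
  by (auto simp: ultra_summit_set_def)

lemma cycling_in_U:
  assumes "y \<in> U"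
  shows "cycling y \<in> U"
proof -
  obtain n where n: "n > 0" "(cycling ^^ n) y = y"
    using assms by (auto simp: ultra_summit_set_def)
  have "(cycling ^^ n) (cycling y) = cycling y"
    using n by (metis funpow_swap1)
  then show ?thesis
    using assms n U_subset_S cycling_in_S by (intro U_I[of _ n]) auto
qed

lemma inj_on_cycling_U: "inj_on cycling U"
  by (rule inj_on_subset[OF inj_on_periodic]) (auto simp: ultra_summit_set_def)

text \<open>Transport fixes \<open>\<delta>\<close>, so cycling commutes with conjugation by
  \<open>\<delta>\<close>.\<close>

lemma cycling_conjugate_delta:
  assumes "y \<in> S"
  shows "cycling (conjugate y \<delta>) = conjugate (cycling y) \<delta>"
proof -
  have y: "y \<in> carrier G" using assms S_closed by blast
  have "inf_exp (conjugate y (dpow 1)) = inf_exp y"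
    using conjugate_dpow_in_S assms inf_exp_S by blast
  then have "transport y (dpow 1) = dpow 1"
    using transport_dpow[OF y] by blast
  then show ?thesis
    using conjugate_cycling_transport[OF y, of \<delta>] by simp
qed

lemma conjugate_delta_in_U:
  assumes "y \<in> U"
  shows "conjugate y \<delta> \<in> U"
proof -
  have yS: "y \<in> S" using assms U_subset_S by blast
  obtain n where n: "n > 0" "(cycling ^^ n) y = y"
    using assms by (auto simp: ultra_summit_set_def)
  have "(cycling ^^ j) (conjugate y \<delta>) = conjugate ((cycling ^^ j) y) \<delta>" for j
  proof (induction j)
    case (Suc j)
    have "(cycling ^^ j) y \<in> S"
      using cycling_in_S yS by (intro funpow_in) auto
    then show ?case using Suc by (simp add: cycling_conjugate_delta)
  qed simp
  then show ?thesis
    using n conjugate_dpow_in_S[OF yS, of 1] by (intro U_I[of _ n]) simp_all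
qed

text \<open>
  Transport along cycling permutes the finite set of pairs \<open>(w, s)\<close> with \<open>w\<close> and \<open>w\<^sup>s\<close> in
  \<open>U\<close> and \<open>\<one> \<preceq> s \<preceq> \<delta>\<^sup>n\<close>, so some iterate fixes \<open>(y, s)\<close>. As transport preserves gcds and
  \<open>\<delta>\<close>, that iterate fixes \<open>(y, s \<and> \<delta>)\<close> too.
\<close>

lemma conjugate_lgcd_delta_in_U:
  assumes "y \<in> U" "s \<in> M" "conjugate y s \<in> U"
  shows "conjugate y (lgcd s \<delta>) \<in> U"
proof -
  obtain n where n: "n \<ge> 0" "s \<preceq> dpow n" using M_prefix_dpow assms(2) by blast
  define A where "A = {(w, s). w \<in> U \<and> conjugate w s \<in> U \<and> s \<in> M \<and> s \<preceq> dpow n}"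
  define T where "T = (\<lambda>(w, s). (cycling w, transport w s))"
  have "A \<subseteq> U \<times> {s \<in> M. s \<preceq> dpow (int (nat n))}"
    using n by (auto simp: A_def)
  then have fin: "finite A"
    using finite_U finite_prefix_dpow by (meson finite_SigmaI finite_subset)
  have "T ` A \<subseteq> A"
    using cycling_in_U U_subset_S U_closed transport_in_M
    by (auto simp: A_def T_def conjugate_cycling_transport subset_iff)
  moreover have "inj_on T A"
  proof (rule inj_onI)
    fix p q assume pq: "p \<in> A" "q \<in> A" "T p = T q"
    obtain w s w' s' where ws: "p = (w, s)" "q = (w', s')" by fastforce
    have U: "w \<in> U" "w' \<in> U" "conjugate w s \<in> U" "conjugate w' s' \<in> U" and M: "s \<in> M" "s' \<in> M"
      using pq(1,2) by (simp_all add: A_def ws)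
    have "cycling w = cycling w'" and tr: "transport w s = transport w' s'"
      using pq(3) by (simp_all add: T_def ws)
    then have w: "w' = w"
      using inj_onD[OF inj_on_cycling_U] U by metis
    have wG: "w \<in> carrier G" using U U_closed by blast
    \<comment> \<open>Equal transports give equal cyclings of the two conjugates. Injectivity of
      cycling on \<open>U\<close> identifies the conjugates, hence their initial factors, and these
      cancel from the transports.\<close>
    have "cycling (conjugate w s) = cycling (conjugate w s')"
      using conjugate_cycling_transport[OF wG, of s]
        conjugate_cycling_transport[OF wG, of s'] tr M by (simp add: w)
    then have "conjugate w s = conjugate w s'"
      using inj_onD[OF inj_on_cycling_U] U unfolding w by blast
    then have "s = s'"
      using tr wG M by (simp add: transport_def m_assoc w)
    then show "p = q" by (simp add: ws w)
  qed
  moreover have ysA: "(y, s) \<in> A"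
    using assms n by (simp add: A_def)
  ultimately obtain K where K: "K > 0" "(T ^^ K) (y, s) = (y, s)"
    using finite_inj_on_periodic[OF fin, of T "(y, s)"] by auto
  define r where "r = lgcd s \<delta>"
  have y: "y \<in> carrier G" using assms U_closed by blast
  have rS: "conjugate y r \<in> S"
    unfolding r_def using assms U_subset_S y conjugate_dpow_in_S[of y 1]
    by (intro conjugate_lgcd_in_S) auto
  have "(T ^^ j) (y, r) = (fst ((T ^^ j) (y, s)), lgcd (snd ((T ^^ j) (y, s))) \<delta>)" for j
  proof (induction j)
    case (Suc j)
    obtain w t where wt: "(T ^^ j) (y, s) = (w, t)" by fastforce
    have "(w, t) \<in> A"
      unfolding wt[symmetric] using \<open>T ` A \<subseteq> A\<close> ysA by (rule funpow_in)
    then have "w \<in> U" "conjugate w t \<in> U" "t \<in> M"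
      by (simp_all add: A_def)
    then have w: "w \<in> S" "conjugate w t \<in> S" "t \<in> M" "w \<in> carrier G"
      using U_subset_S U_closed[of w] by (simp_all add: subset_iff)
    have d: "conjugate w \<delta> \<in> S"
      using conjugate_dpow_in_S[OF w(1), of 1] by simp
    then have l: "conjugate w (lgcd t \<delta>) \<in> S"
      using w by (intro conjugate_lgcd_in_S) simp_all
    have "transport w (lgcd t \<delta>) = lgcd (transport w t) (transport w \<delta>)"
      using w inf_exp_S[OF w(1) w(2)] inf_exp_S[OF w(1) d] inf_exp_S[OF w(1) l]
      by (intro transport_lgcd) simp_all
    moreover have "transport w \<delta> = \<delta>"
      using transport_dpow[OF w(4), of 1] inf_exp_S[OF w(1) d] by simp
    ultimately show ?case
      using Suc wt by (simp add: T_def)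
  qed (simp add: r_def)
  then have Kr: "(T ^^ K) (y, r) = (y, r)"
    using K by (simp add: r_def)
  \<comment> \<open>Iterating \<open>T\<close> on a pair amounts to cycling the conjugate it
    encodes, so the period of \<open>(y, r)\<close> becomes a period of
    \<open>conjugate y r\<close>.\<close>
  have it: "(cycling ^^ j) (conjugate y r) = conjugate (fst ((T ^^ j) (y, r))) (snd ((T ^^ j) (y, r))) \<and>
      fst ((T ^^ j) (y, r)) \<in> carrier G \<and> snd ((T ^^ j) (y, r)) \<in> carrier G" for j
  proof (induction j)
    case 0
    then show ?case using y assms by (simp add: r_def)
  next
    case (Suc j)
    then show ?case
      by (cases "(T ^^ j) (y, r)") (simp add: T_def conjugate_cycling_transport)
  qed
  have "(cycling ^^ K) (conjugate y r) = conjugate y r"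
    using it[of K] Kr by simp
  then show ?thesis
    using rS K U_I by (simp add: r_def)
qed

section \<open>Chains of simple conjugations\<close>

definition simple_conj :: "('a \<times> 'a) set" where
  "simple_conj = {(u, v). u \<in> U \<and> v \<in> U \<and> (\<exists>c\<in>simples. conjugate u c = v)}"

text \<open>The first step conjugates by \<open>r = lgcd s \<delta>\<close> and stays in
  \<open>U\<close>; the remaining conjugator is a prefix of a power of \<open>\<delta>\<close> with
  exponent one lower.\<close>

lemma conjugate_simple_conj:
  assumes "y \<in> U" "s \<in> M" "s \<preceq> dpow (int n)" "conjugate y s \<in> U"
  shows "(y, conjugate y s) \<in> simple_conj\<^sup>*"
  using assms
proof (induction n arbitrary: y s)
  case 0
  then have "s = \<one>" by (simp add: prefix_one_iff)
  then show ?case using 0 U_closed by simp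
next
  case (Suc n)
  define r t where "r = lgcd s \<delta>" and "t = inv r \<otimes> s"
  have y: "y \<in> carrier G" using Suc U_closed by blast
  have r: "r \<in> simples" "r \<in> M" and t: "t \<in> M"
    using Suc.prems lgcd_cofactor_M by (simp_all add: r_def t_def lgcd_simple lgcd_M)
  have "t \<preceq> dpow (int n)"
    using Suc.prems prefix_lgcd_dpow[of s "int n"] by (simp add: r_def t_def add.commute)
  moreover have eq: "conjugate (conjugate y r) t = conjugate y s"
    using y r t Suc.prems by (simp add: conjugate_conjugate t_def)
  moreover have rU: "conjugate y r \<in> U"
    unfolding r_def using Suc.prems by (intro conjugate_lgcd_delta_in_U)
  ultimately have "(conjugate y r, conjugate y s) \<in> simple_conj\<^sup>*"
    using Suc.IH[of "conjugate y r" t] t Suc.prems by simp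
  moreover have "(y, conjugate y r) \<in> simple_conj"
    using Suc.prems rU r by (auto simp: simple_conj_def)
  ultimately show ?case by (rule converse_rtrancl_into_rtrancl[rotated])
qed

lemma U_connected:
  assumes "y \<in> U" "z \<in> U"
  shows "(y, z) \<in> simple_conj\<^sup>*"
proof -
  have yz: "y \<in> carrier G" "z \<in> carrier G" using assms U_closed by auto
  have "y \<in> conjugates x" "z \<in> conjugates x"
    using assms by (simp_all add: ultra_summit_set_def super_summit_set_def)
  then obtain a b where ab: "a \<in> carrier G" "b \<in> carrier G" "y = conjugate x a" "z = conjugate x b"
    by (auto simp: conjugates_def)
  define c where "c = inv a \<otimes> b"
  have c: "c \<in> carrier G" "conjugate y c = z"
    using ab x by (simp_all add: c_def conjugate_conjugate)
  let ?t = "\<lambda>w. conjugate w \<delta>"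
  have "inj_on ?t U"
  proof (rule inj_onI)
    fix u v assume "u \<in> U" "v \<in> U" "?t u = ?t v"
    then show "u = v" using U_closed by (simp add: conjugate_def)
  qed
  then obtain e where e: "e > 0" "(?t ^^ e) z = z"
    using finite_inj_on_periodic[of U ?t z] finite_U conjugate_delta_in_U assms by blast
  have tpow: "(?t ^^ j) z = conjugate z (dpow (int j))" for j
  proof (induction j)
    case (Suc j)
    have "dpow (int j) \<otimes> \<delta> = dpow (int (Suc j))"
      using dpow_mult[of "int j" 1] by (simp add: add.commute)
    then show ?case
      using Suc yz by (simp add: conjugate_conjugate del: of_nat_Suc)
  qed (use yz in simp)
  obtain n where n: "n \<ge> 0" "\<And>m. m \<ge> n \<Longrightarrow> c \<otimes> dpow m \<in> M"
    using eventually_mult_dpow_M[OF c(1)] by blast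
  \<comment> \<open>As a multiple of the period \<open>e\<close>, the exponent \<open>j\<close>
    makes \<open>dpow j\<close> commute with \<open>z\<close>, so the target is unchanged; being at
    least \<open>n\<close>, it brings the conjugator into \<open>M\<close>.\<close>
  define j where "j = e * nat n"
  have "nat n \<le> j" using e by (simp add: j_def)
  then have cM: "c \<otimes> dpow (int j) \<in> M"
    using n by (intro n(2)) simp
  have "conjugate y (c \<otimes> dpow (int j)) = (?t ^^ j) z"
    using yz c by (simp add: tpow flip: conjugate_conjugate)
  also have "\<dots> = z"
    unfolding j_def using e(2) by (rule funpow_fixed_mult)
  finally have z: "conjugate y (c \<otimes> dpow (int j)) = z" .
  obtain l where l: "l \<ge> 0" "c \<otimes> dpow (int j) \<preceq> dpow l"
    using M_prefix_dpow[OF cM] by blast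
  then show ?thesis
    using conjugate_simple_conj[OF assms(1) cM, of "nat l"] z assms by simp
qed

end

end

text \<open>Every element of \<open>M\<close> is a prefix of a power of \<open>\<delta>\<close>,
  that is, of \<open>\<one>\<close>. This settles the case excluded from the results on
  infima.\<close>

lemma carrier_trivial:
  assumes "\<delta> = \<one>"
  shows "carrier G = {\<one>}"
proof -
  have M: "a = \<one>" if "a \<in> M" for a
    using M_prefix_dpow[OF that] that assms by (simp add: prefix_one_iff)
  have "g = \<one>" if "g \<in> carrier G" for g
    using eventually_mult_dpow_M[OF that] M that assms by fastforce
  then show ?thesis by auto
qed

end

theorem corollary1p18:
  fixes G (structure) and M :: "'a set" and \<delta> x y z :: 'a
  assumes "garside_group G M \<delta>"
    and "x \<in> carrier G"
    and "y \<in> garside_group.ultra_summit_set G M \<delta> x"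
    and "z \<in> garside_group.ultra_summit_set G M \<delta> x"
  shows "\<exists>(t::nat) (ys :: nat \<Rightarrow> 'a) (cs :: nat \<Rightarrow> 'a).
           (\<forall>i\<in>{0..t}. ys i \<in> garside_group.ultra_summit_set G M \<delta> x) \<and>
           (\<forall>i\<in>{1..t}. cs i \<in> garside_group.simples G M \<delta>) \<and>
           ys 0 = y \<and> ys t = z \<and>
           (\<forall>i\<in>{1..t}. garside_group.conjugate G (ys (i - 1)) (cs i) = ys i)"
proof -
  interpret garside_group G M \<delta> by fact
  have yz: "y \<in> carrier G" "z \<in> carrier G"
    using assms conjugates_closed[of x]
    by (simp_all add: ultra_summit_set_def super_summit_set_def)
  show ?thesis
  proof (cases "\<delta> = \<one>")
    case True
    then have "y = z"
      using carrier_trivial yz by simp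
    then show ?thesis
      using assms by (intro exI[of _ 0] exI[of _ "\<lambda>_. y"]) auto
  next
    case False
    then have "(y, z) \<in> (simple_conj x)\<^sup>*"
      using U_connected assms by blast
    then obtain t where "(y, z) \<in> simple_conj x ^^ t"
      using rtrancl_imp_relpow by blast
    then obtain ys where ys: "ys 0 = y" "ys t = z" "\<And>i. i < t \<Longrightarrow> (ys i, ys (Suc i)) \<in> simple_conj x"
      unfolding relpow_fun_conv by blast
    have step: "ys (Suc i) \<in> ultra_summit_set x" "\<exists>c. c \<in> simples \<and> conjugate (ys i) c = ys (Suc i)"
      if "i < t" for i
      using ys(3)[OF that] unfolding simple_conj_def[OF False assms(2)] by auto
    then obtain cs where cs: "\<And>i. i < t \<Longrightarrow> cs i \<in> simples \<and> conjugate (ys i) (cs i) = ys (Suc i)"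
      by metis
    have "ys i \<in> ultra_summit_set x" if "i \<le> t" for i
    proof (cases i)
      case 0
      then show ?thesis using ys(1) assms(3) by simp
    next
      case (Suc j)
      then show ?thesis using step(1)[of j] that by simp
    qed
    moreover have "cs (i - 1) \<in> simples" "conjugate (ys (i - 1)) (cs (i - 1)) = ys i"
      if "i \<in> {1..t}" for i
    proof -
      have "i - 1 < t" "Suc (i - 1) = i" using that by auto
      then show "cs (i - 1) \<in> simples" "conjugate (ys (i - 1)) (cs (i - 1)) = ys i"
        using cs[of "i - 1"] by simp_all
    qed
    ultimately show ?thesis
      using ys(1,2)
      \<comment> \<open>The chain numbers its conjugators from 0, \<open>cs i\<close> leading from
        \<open>ys i\<close> to \<open>ys (Suc i)\<close>; the claim numbers them from 1, hence the
        shift.\<close>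
      by (intro exI[of _ t] exI[of _ ys] exI[of _ "\<lambda>i. cs (i - 1)"] conjI ballI)
        (simp_all only: atLeastAtMost_iff)
  qed
qed

end
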